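(* Let $\mathbb{F}$ be an algebraically closed field and let $n\ge 3$. Let $A\in M_n(\mathbb{F})$ be a non-scalar matrix. Then the following are equivalent. (i) $A$ is semisimple (i.e. diagonalizable). (ii) There exists a minimal matrix $B\in\mathcal{C}(A)$ such that for any path $Y - X - B$ in the commuting graph $\Gamma(M_n(\mathbb{F}))$ there exists a minimal matrix $M$ such that $Y - M - X$ is a path in $\Gamma(M_n(\mathbb{F}))$.
   Context: For $A\in M_n(\mathbb{F})$, $\mathcal{C}(A)=\{X\in M_n(\mathbb{F}): AX=XA\}$. A matrix $A$ is minimal if $\mathcal{C}(X)\subseteq\mathcal{C}(A)$ implies $\mathcal{C}(X)=\mathcal{C}(A)$ for every $X\in M_n(\mathbb{F})$ (equivalently, $A$ is nonderogatory: every eigenvalue has geometric multiplicity one). The commuting graph $\Gamma(M_n(\mathbb{F}))$ is the simple graph whose vertices are all non-scalar matrices in $M_n(\mathbb{F})$; two vertices $X,Y$ form an edge, written $X - Y$, iff $X\ne Y$ and $XY=YX$. A path $X_0 - X_1 - X_2$ means that $X_0 - X_1$ and $X_1 - X_2$ are edges (no requirement that $X_0\neq X_2$). *)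

theory Defs
  imports
    "Jordan_Normal_Form.Matrix"
    "Graph_Theory.Graph_Theory"
    "HOL-Computational_Algebra.Polynomial"
begin

definition diagonalizable_mat :: "'a::semiring_1 mat \<Rightarrow> bool" where
  "diagonalizable_mat A \<longleftrightarrow> (\<exists>D. diagonal_mat D \<and> similar_mat A D)"

definition scalar_matrices :: "nat \<Rightarrow> 'a::semiring_1 mat set" where
  "scalar_matrices n = {c \<cdot>\<^sub>m 1\<^sub>m n | c. True}"

definition centralizer_mat :: "nat \<Rightarrow> 'a::semiring_0 mat \<Rightarrow> 'a mat set" where
  "centralizer_mat n A = {X \<in> carrier_mat n n. A * X = X * A}"

definition minimal_mat :: "nat \<Rightarrow> 'a::semiring_0 mat \<Rightarrow> bool" where
  "minimal_mat n A \<longleftrightarrow> A \<in> carrier_mat n n \<and>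
     (\<forall>X\<in>carrier_mat n n. centralizer_mat n X \<subseteq> centralizer_mat n A
        \<longrightarrow> centralizer_mat n X = centralizer_mat n A)"

text \<open>
  The simple graph is encoded as a loop-free symmetric pair digraph. It may be infinite, so it
  need not satisfy the locale \<^locale>\<open>graph\<close>, which requires finiteness.
\<close>

definition commuting_graph :: "nat \<Rightarrow> 'a::semiring_1 mat pair_pre_digraph" where
  "commuting_graph n =
     \<lparr> pverts = carrier_mat n n - scalar_matrices n,
       parcs = {(X, Y). X \<in> carrier_mat n n - scalar_matrices n \<and>
                        Y \<in> carrier_mat n n - scalar_matrices n \<and>
                        X \<noteq> Y \<and> X * Y = Y * X} \<rparr>"

lemma pair_wf_digraph_commuting_graph: "pair_wf_digraph (commuting_graph n)"
  by unfold_locales (auto simp: commuting_graph_def)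

lemma loopfree_commuting_graph: "loopfree_digraph (with_proj (commuting_graph n))"
  by unfold_locales (auto simp: commuting_graph_def)

lemma symmetric_commuting_graph: "symmetric (with_proj (commuting_graph n))"
  by (auto simp: commuting_graph_def symmetric_conv)

text \<open>
  A path \<open>X\<^sub>0 - X\<^sub>1 - X\<^sub>2\<close>, whose endpoints may coincide, is a vertex walk
  \<^const>\<open>vwalk\<close> rather than a \<^const>\<open>vpath\<close>.
\<close>

lemma vwalk_commuting_graph_iff:
  "vwalk [X, Y, Z] (with_proj (commuting_graph n)) \<longleftrightarrow>
     (X, Y) \<in> parcs (commuting_graph n) \<and> (Y, Z) \<in> parcs (commuting_graph n)"
  by (auto simp: vwalk_def commuting_graph_def arcs_ends_conv)

end

theory Submission
  imports
    Defs
    "Jordan_Normal_Form.Jordan_Normal_Form_Existence"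
    "Jordan_Normal_Form.DL_Rank"
begin

text \<open>
  Changing the eigenvalues in a Jordan form so that different blocks get different eigenvalues
  shows that every matrix commutes with a matrix having a cyclic vector; a matrix is minimal iff it
  has a cyclic vector, and then its centralizer is commutative.

  If \<open>A\<close> is diagonalizable, let \<open>B\<close> be diagonal in the same basis with distinct entries. For a path
  \<open>Y - X - B\<close> the matrix \<open>X\<close> is diagonal in this basis, so for generic \<open>c\<close> whatever commutes with
  \<open>Y + c X\<close> commutes with \<open>X\<close> and \<open>Y\<close>. Take for \<open>M\<close> a cyclic matrix commuting with \<open>Y + c X\<close>, shifted by
  a scalar to differ from \<open>X\<close> and \<open>Y\<close>.

  If \<open>A\<close> is not diagonalizable, then neither is any minimal \<open>B\<close> commuting with \<open>A\<close>. In a Jordan basis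
  of \<open>B\<close> let \<open>f\<close> and \<open>l\<close> be the first and last index of a block of size at least 2, let \<open>m\<close> be a
  third index, and take the matrix units \<open>X = E\<^sub>f\<^sub>l\<close> and \<open>Y = E\<^sub>f\<^sub>m\<close>. A matrix commuting with both has two
  independent left eigenvectors for one eigenvalue, so it is not minimal.
\<close>

subsection \<open>Jordan form over an algebraically closed field\<close>

text \<open>Over a finite field the product of all X - a, plus 1, takes the value 1 everywhere and
  so has no root. Infinitude supplies the distinct eigenvalues, the generic coefficients and the
  scalar shifts chosen later.\<close>

lemma infinite_UNIV_alg_closed: "infinite (UNIV :: 'a::alg_closed_field set)"
proof
  assume fin: "finite (UNIV :: 'a set)"
  define p :: "'a poly" where "p = (\<Prod>a\<in>UNIV. [:-a, 1:])"
  have "degree p = card (UNIV :: 'a set)"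
    unfolding p_def by (subst degree_prod_eq_sum_degree) (auto simp: fin)
  hence "degree p > 0" using fin by (simp add: card_gt_0_iff)
  hence "degree (p + 1) > 0" by (subst degree_add_eq_left) auto
  then obtain x where "poly (p + 1) x = 0" using alg_closed_imp_poly_has_root by blast
  moreover have "poly p x = 0" unfolding p_def poly_prod using fin by (auto intro!: bexI[of _ x])
  ultimately show False by simp
qed

text \<open>Complete \<open>v\<close> to a basis whose head is \<open>v\<close>; the matrix with
  these columns has full rank and is therefore invertible.\<close>

lemma exists_mat_first_col:
  fixes v :: "'a::field vec"
  assumes v: "v \<in> carrier_vec n" and v0: "v \<noteq> 0\<^sub>v n"
  obtains P Q where "P \<in> carrier_mat n n" "Q \<in> carrier_mat n n" "P * Q = 1\<^sub>m n" "Q * P = 1\<^sub>m n" "col P 0 = v"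
proof -
  interpret vec_space "TYPE('a)" n .
  define b where "b = basis_completion v"
  note bc = basis_completion[OF v v0, folded b_def]
  define P where "P = mat_of_cols n b"
  have P: "P \<in> carrier_mat n n" unfolding P_def using bc(6) mat_of_cols_carrier(1)[of n b] by simp
  have colsP: "cols P = b" unfolding P_def using bc(2) by simp
  have "rank P = n" by (rule lin_indpt_full_rank[OF P]) (auto simp: colsP bc)
  hence "det P \<noteq> 0" using det_rank_iff[OF P] by simp
  from det_non_zero_imp_unit[OF P this, of "()"] obtain Q where
    Q: "Q \<in> carrier_mat n n" "P * Q = 1\<^sub>m n" "Q * P = 1\<^sub>m n"
    by (auto simp: Units_def ring_mat_simps)
  have n: "n > 0" using v v0 by (cases n) auto
  hence "col P 0 = b ! 0" unfolding P_def using bc(2,6) by (subst col_mat_of_cols) auto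
  also have "\<dots> = v" using bc(6,7) n by (cases b) auto
  finally show ?thesis using that P Q by blast
qed

lemma exists_eigenvector:
  fixes A :: "'a::alg_closed_field mat"
  assumes A: "A \<in> carrier_mat n n" and n: "n > 0"
  obtains v e where "v \<in> carrier_vec n" "v \<noteq> 0\<^sub>v n" "A *\<^sub>v v = e \<cdot>\<^sub>v v"
proof -
  have "degree (char_poly A) > 0" using degree_monic_char_poly[OF A] n by simp
  then obtain e where "poly (char_poly A) e = 0" using alg_closed_imp_poly_has_root by blast
  hence "eigenvalue A e" using eigenvalue_root_char_poly[OF A] by simp
  thus ?thesis using that A unfolding eigenvalue_def eigenvector_def by auto
qed

text \<open>Deflation: in a basis starting with an eigenvector the first column is a multiple of the
  first unit vector, and the induction hypothesis triangularizes the remaining lower right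
  block.\<close>

lemma similar_upper_triangular:
  fixes A :: "'a::alg_closed_field mat"
  assumes "A \<in> carrier_mat n n"
  shows "\<exists>B \<in> carrier_mat n n. upper_triangular B \<and> similar_mat A B"
  using assms
proof (induction n arbitrary: A)
  case 0
  thus ?case by (intro bexI[of _ A]) (auto intro: similar_mat_refl)
next
  case (Suc n)
  note A = \<open>A \<in> carrier_mat (Suc n) (Suc n)\<close>
  obtain v e where v: "v \<in> carrier_vec (Suc n)" "v \<noteq> 0\<^sub>v (Suc n)" and ev: "A *\<^sub>v v = e \<cdot>\<^sub>v v"
    using exists_eigenvector[OF A] by blast
  obtain P Q where P: "P \<in> carrier_mat (Suc n) (Suc n)" and Q: "Q \<in> carrier_mat (Suc n) (Suc n)"
    and PQ: "P * Q = 1\<^sub>m (Suc n)" "Q * P = 1\<^sub>m (Suc n)" and col: "col P 0 = v"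
    using exists_mat_first_col[OF v] by blast
  define A' where "A' = Q * A * P"
  have A': "A' \<in> carrier_mat (Suc n) (Suc n)" unfolding A'_def using P Q A by simp
  have sim: "similar_mat A A'"
    by (rule similar_mat_sym, rule similar_matI[of _ _ Q P]) (use A A' P Q PQ A'_def in auto)
  \<comment> \<open>The first column of \<open>P\<close> is the eigenvector \<open>v\<close>, so
    \<open>A'\<close> maps the first unit vector to \<open>e\<close> times itself.\<close>
  have "col A' 0 = Q *\<^sub>v (A *\<^sub>v v)"
    unfolding A'_def assoc_mult_mat[OF Q A P] col[symmetric] using P Q A
    by (metis col_mult2 mult_carrier_mat zero_less_Suc)
  also have "\<dots> = e \<cdot>\<^sub>v (Q *\<^sub>v col P 0)" using ev Q v(1) col by (simp add: mult_mat_vec)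
  also have "Q *\<^sub>v col P 0 = col (1\<^sub>m (Suc n)) 0"
    unfolding PQ(2)[symmetric] by (rule col_mult2[OF Q P, symmetric]) simp
  finally have c0: "col A' 0 = e \<cdot>\<^sub>v unit_vec (Suc n) 0" by simp
  obtain A1 A2 A0 A3 where sp: "split_block A' 1 1 = (A1, A2, A0, A3)"
    by (cases "split_block A' 1 1") auto
  have d: "dim_row A' = 1 + n" "dim_col A' = 1 + n" using A' by auto
  note blk = split_block[OF sp d]
  have "A0 = 0\<^sub>m n 1"
  proof (rule eq_matI)
    fix i j assume ij: "i < dim_row (0\<^sub>m n 1)" "j < dim_col (0\<^sub>m n 1)"
    have "A0 $$ (i, 0) = A' $$ (Suc i, 0)"
      using sp ij A' by (auto simp: split_block_def Let_def)
    also have "\<dots> = col A' 0 $ Suc i" using A' ij by simp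
    also have "\<dots> = 0" unfolding c0 using ij by simp
    finally show "A0 $$ (i, j) = 0\<^sub>m n 1 $$ (i, j)" using ij by simp
  qed (use blk in auto)
  hence A'eq: "A' = four_block_mat A1 A2 (0\<^sub>m n 1) A3" using blk by simp
  from Suc.IH[OF blk(4)] obtain B3 where B3: "B3 \<in> carrier_mat n n" "upper_triangular B3" "similar_mat A3 B3"
    by blast
  \<comment> \<open>A similarity of the lower block extends to the whole matrix; it keeps
    \<open>A1\<close> and the zero block and only turns the upper right row \<open>A2\<close> into
    some \<open>B0\<close>.\<close>
  obtain B0 where B0: "B0 \<in> carrier_mat 1 n"
    "similar_mat A' (four_block_mat A1 B0 (0\<^sub>m n 1) B3)"
    unfolding A'eq using similar_mat_four_block_0_ex[OF similar_mat_refl[OF blk(1)] B3(3) blk(2,1,4)] by blast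
  let ?B = "four_block_mat A1 B0 (0\<^sub>m n 1) B3"
  have "upper_triangular A1" using blk(1) by auto
  hence B: "upper_triangular ?B"
    using upper_triangular_four_block[OF blk(1) B3(1) _ B3(2)] by simp
  have carr: "?B \<in> carrier_mat (Suc n) (Suc n)"
    using four_block_carrier_mat[OF blk(1) B3(1)] by simp
  show ?case by (rule bexI[of _ ?B], rule conjI, rule B, rule similar_mat_trans[OF sim B0(2)], rule carr)
qed

lemma similar_jordan_matrix:
  fixes A :: "'a::alg_closed_field mat"
  assumes "A \<in> carrier_mat n n"
  shows "\<exists>n_as. similar_mat A (jordan_matrix n_as)"
proof -
  obtain B where B: "B \<in> carrier_mat n n" "upper_triangular B" and AB: "similar_mat A B"
    using similar_upper_triangular[OF assms] by blast
  have "similar_mat B (jordan_matrix (triangular_to_jnf_vector B))"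
    using triangular_to_jnf_vector[OF B] unfolding jordan_nf_def by (rule conjunct2)
  from similar_mat_trans[OF AB this] show ?thesis by (rule exI)
qed

text \<open>
  A Jordan matrix is encoded by its diagonal \<open>d\<close> and the set \<open>s\<close> of rows carrying a superdiagonal
  entry 1; compatibility of the two says that \<open>d\<close> is constant along each Jordan block.
\<close>

definition linked_mat :: "nat \<Rightarrow> (nat \<Rightarrow> 'a) \<Rightarrow> (nat \<Rightarrow> bool) \<Rightarrow> 'a::semiring_1 mat" where
  "linked_mat n d s = mat n n (\<lambda>(i, j). if i = j then d i else if j = Suc i \<and> s i then 1 else 0)"

definition compatible_links :: "nat \<Rightarrow> (nat \<Rightarrow> 'a) \<Rightarrow> (nat \<Rightarrow> bool) \<Rightarrow> bool" where
  "compatible_links n d s \<longleftrightarrow> (\<forall>i. s i \<longrightarrow> Suc i < n \<and> d (Suc i) = d i)"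

text \<open>Induction on the list of blocks: prepending a block of size \<open>k\<close> shifts the
  old diagonal and the old links by \<open>k\<close>.\<close>

lemma jordan_matrix_linked:
  "\<exists>d s. jordan_matrix n_as = linked_mat (sum_list (map fst n_as)) d s \<and>
         compatible_links (sum_list (map fst n_as)) d s"
proof (induction n_as)
  case Nil
  show ?case
    by (rule exI[of _ "\<lambda>_. 0"], rule exI[of _ "\<lambda>_. False"])
       (auto simp: jordan_matrix_def linked_mat_def compatible_links_def intro!: eq_matI)
next
  case (Cons na n_as)
  obtain k a where na: "na = (k, a)" by (cases na) auto
  let ?m = "sum_list (map fst n_as)"
  from Cons obtain d s where J: "jordan_matrix n_as = linked_mat ?m d s"
    and c: "compatible_links ?m d s" by blast
  define d' where "d' i = (if i < k then a else d (i - k))" for i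
  \<comment> \<open>Inside the new block the condition is \<open>Suc i < k\<close>, so its last row
    carries no link into the following block.\<close>
  define s' where "s' i = (if i < k then Suc i < k else s (i - k))" for i
  have "jordan_matrix (na # n_as) =
      four_block_mat (jordan_block k a) (0\<^sub>m k ?m) (0\<^sub>m ?m k) (linked_mat ?m d s)"
    using jordan_matrix_dim[of n_as]
    by (simp add: na jordan_matrix_def Let_def J[unfolded jordan_matrix_def] linked_mat_def)
  also have "\<dots> = linked_mat (k + ?m) d' s'"
  proof (rule eq_matI)
    fix i j assume "i < dim_row (linked_mat (k + ?m) d' s')" "j < dim_col (linked_mat (k + ?m) d' s')"
    hence ij: "i < k + ?m" "j < k + ?m" by (simp_all add: linked_mat_def)
    have "four_block_mat (jordan_block k a) (0\<^sub>m k ?m) (0\<^sub>m ?m k) (linked_mat ?m d s) $$ (i, j) =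
        (if i < k then if j < k then jordan_block k a $$ (i, j) else 0
         else if j < k then 0 else linked_mat ?m d s $$ (i - k, j - k))"
      using ij by (subst index_mat_four_block) (auto simp: linked_mat_def)
    also have "\<dots> = linked_mat (k + ?m) d' s' $$ (i, j)"
    proof -
      consider "i < k" "j < k" | "i < k" "\<not> j < k" | "\<not> i < k" "j < k"
        | i' j' where "i = k + i'" "j = k + j'"
        by (metis le_add_diff_inverse not_less)
      thus ?thesis
        by cases (use ij in \<open>auto simp: linked_mat_def d'_def s'_def\<close>)
    qed
    finally show "four_block_mat (jordan_block k a) (0\<^sub>m k ?m) (0\<^sub>m ?m k) (linked_mat ?m d s) $$ (i, j) =
        linked_mat (k + ?m) d' s' $$ (i, j)" .
  qed (simp_all add: linked_mat_def)
  finally have "jordan_matrix (na # n_as) = linked_mat (k + ?m) d' s'" .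
  moreover have "compatible_links (k + ?m) d' s'"
    unfolding compatible_links_def
  proof (intro allI impI)
    fix i assume "s' i"
    show "Suc i < k + ?m \<and> d' (Suc i) = d' i"
    proof (cases "i < k")
      case True
      thus ?thesis using \<open>s' i\<close> by (simp add: s'_def d'_def)
    next
      case False
      hence "s (i - k)" "Suc i - k = Suc (i - k)" using \<open>s' i\<close> by (auto simp: s'_def)
      thus ?thesis using False c unfolding compatible_links_def d'_def by fastforce
    qed
  qed
  ultimately show ?case by (auto simp: na)
qed

section \<open>Products, intertwiners and commutation of linked matrices\<close>

lemma linked_mat_carrier [simp]: "linked_mat n d s \<in> carrier_mat n n"
  by (simp add: linked_mat_def)

lemma linked_mat_dim [simp]: "dim_row (linked_mat n d s) = n" "dim_col (linked_mat n d s) = n"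
  by (simp_all add: linked_mat_def)

lemma linked_mat_mult_left:
  fixes Z :: "'a::field mat"
  assumes "Z \<in> carrier_mat n m" "i < n" "j < m" "s i \<Longrightarrow> Suc i < n"
  shows "(linked_mat n d s * Z) $$ (i, j) = d i * Z $$ (i, j) + (if s i then Z $$ (Suc i, j) else 0)"
proof -
  have "(linked_mat n d s * Z) $$ (i, j) = (\<Sum>k<n. linked_mat n d s $$ (i, k) * Z $$ (k, j))"
    using assms by (simp add: scalar_prod_def atLeast0LessThan)
  also have "\<dots> = (\<Sum>k<n. (if k = i then d i * Z $$ (i, j) else 0) +
      (if k = Suc i then if s i then Z $$ (Suc i, j) else 0 else 0))"
    using assms by (intro sum.cong) (auto simp: linked_mat_def)
  also have "\<dots> = d i * Z $$ (i, j) + (if s i then Z $$ (Suc i, j) else 0)"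
    using assms by (auto simp: sum.distrib)
  finally show ?thesis .
qed

lemma linked_mat_mult_right:
  fixes Z :: "'a::field mat"
  assumes "Z \<in> carrier_mat m n" "i < m" "j < n"
  shows "(Z * linked_mat n d s) $$ (i, j) =
    Z $$ (i, j) * d j + (if j > 0 \<and> s (j - 1) then Z $$ (i, j - 1) else 0)"
proof -
  have "(Z * linked_mat n d s) $$ (i, j) = (\<Sum>k<n. Z $$ (i, k) * linked_mat n d s $$ (k, j))"
    using assms by (simp add: scalar_prod_def atLeast0LessThan)
  \<comment> \<open>For \<open>j = 0\<close> the truncated \<open>j - 1\<close> is again 0; the
    guard \<open>j > 0\<close> removes the spurious second term.\<close>
  also have "\<dots> = (\<Sum>k<n. (if k = j then Z $$ (i, j) * d j else 0) +
      (if k = j - 1 then if j > 0 \<and> s (j - 1) then Z $$ (i, j - 1) else 0 else 0))"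
    using assms by (intro sum.cong) (auto simp: linked_mat_def)
  also have "\<dots> = Z $$ (i, j) * d j + (if j > 0 \<and> s (j - 1) then Z $$ (i, j - 1) else 0)"
    using assms by (auto simp: sum.distrib)
  finally show ?thesis .
qed

text \<open>At (i, j) the equation expresses (d i - d' j) Z_ij through Z at (i + 1, j) and (i, j -
  1). Along links these positions have the same pair of eigenvalues, so induction starting from the
  lower left corner kills them. Two different diagonals are allowed so that an eigenvalue shift can
  be absorbed into one of them.\<close>

lemma linked_mat_intertwine_zero:
  fixes Z :: "'a::field mat"
  assumes c: "compatible_links n d s" "compatible_links n d' s'"
    and Z: "Z \<in> carrier_mat n n" and eq: "linked_mat n d s * Z = Z * linked_mat n d' s'"
  shows "i < n \<Longrightarrow> j < n \<Longrightarrow> d i \<noteq> d' j \<Longrightarrow> Z $$ (i, j) = 0"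
proof (induction "n - i + j" arbitrary: i j rule: less_induct)
  case less
  have 1: "Z $$ (Suc i, j) = 0" if "s i"
  proof (rule less.hyps)
    show "Suc i < n" "d (Suc i) \<noteq> d' j" using c that less.prems by (auto simp: compatible_links_def)
    thus "n - Suc i + j < n - i + j" by simp
  qed fact
  have 2: "Z $$ (i, j - 1) = 0" if "j > 0" "s' (j - 1)"
  proof (rule less.hyps)
    have "d' (Suc (j - 1)) = d' (j - 1)" using c that unfolding compatible_links_def by blast
    thus "d i \<noteq> d' (j - 1)" using that less.prems by simp
  qed (use that less.prems in auto)
  have "(linked_mat n d s * Z) $$ (i, j) = (Z * linked_mat n d' s') $$ (i, j)" using eq by simp
  moreover have "s i \<Longrightarrow> Suc i < n" using c by (simp add: compatible_links_def)
  ultimately have "d i * Z $$ (i, j) = Z $$ (i, j) * d' j"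
    using 1 2 less.prems by (simp add: linked_mat_mult_left[OF Z] linked_mat_mult_right[OF Z] split: if_splits)
  thus ?case using less.prems by (simp add: mult.commute)
qed

text \<open>Both factors are a diagonal matrix plus the same shift, and a diagonal that is constant
  along the links commutes with this shift.\<close>

lemma linked_mat_commute:
  fixes d e :: "nat \<Rightarrow> 'a::field"
  assumes "compatible_links n d s" "compatible_links n e s"
  shows "linked_mat n d s * linked_mat n e s = linked_mat n e s * linked_mat n d s"
proof (rule eq_matI)
  fix i j assume "i < dim_row (linked_mat n e s * linked_mat n d s)"
    "j < dim_col (linked_mat n e s * linked_mat n d s)"
  hence ij: "i < n" "j < n" by simp_all
  have s: "s i \<Longrightarrow> Suc i < n \<and> d (Suc i) = d i \<and> e (Suc i) = e i"
    using assms by (simp add: compatible_links_def)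
  show "(linked_mat n d s * linked_mat n e s) $$ (i, j) = (linked_mat n e s * linked_mat n d s) $$ (i, j)"
  proof -
    have mult: "(linked_mat n f s * linked_mat n g s) $$ (i, j) =
        f i * linked_mat n g s $$ (i, j) + (if s i then linked_mat n g s $$ (Suc i, j) else 0)"
      for f g :: "nat \<Rightarrow> 'a"
      using s by (intro linked_mat_mult_left[OF linked_mat_carrier ij]) blast
    show ?thesis unfolding mult using ij s by (auto simp: linked_mat_def)
  qed
qed simp_all

text \<open>Different Jordan blocks have different eigenvalues, i.e. the matrix is nonderogatory.\<close>

definition separated_links :: "nat \<Rightarrow> (nat \<Rightarrow> 'a) \<Rightarrow> (nat \<Rightarrow> bool) \<Rightarrow> bool" where
  "separated_links n d s \<longleftrightarrow> compatible_links n d s \<and>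
     (\<forall>i j k. i \<le> k \<and> k < j \<and> j < n \<and> d i = d j \<longrightarrow> s k)"

text \<open>Number the blocks consecutively and map these numbers injectively into the infinite
  field.\<close>

lemma exists_separated_links:
  fixes d :: "nat \<Rightarrow> 'a::alg_closed_field"
  assumes "compatible_links n d s"
  obtains e :: "nat \<Rightarrow> 'a" where "separated_links n e s"
proof -
  obtain c :: "nat \<Rightarrow> 'a" where c: "inj c"
    using infinite_countable_subset[OF infinite_UNIV_alg_closed] by blast
  \<comment> \<open>A row without link is the last one of its block, so \<open>card (B i)\<close>
    counts the blocks that end before row \<open>i\<close>.\<close>
  define B where "B i = {k. k < i \<and> \<not> s k}" for i
  define e where "e i = c (card (B i))" for i
  have fin: "finite (B i)" for i by (simp add: B_def)
  have "separated_links n e s"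
    unfolding separated_links_def compatible_links_def
  proof (intro conjI allI impI)
    fix i assume "s i"
    thus "Suc i < n" using assms by (simp add: compatible_links_def)
    have "B (Suc i) = B i" using \<open>s i\<close> by (auto simp: B_def less_Suc_eq)
    thus "e (Suc i) = e i" by (simp add: e_def)
  next
    fix i j k assume *: "i \<le> k \<and> k < j \<and> j < n \<and> e i = e j"
    \<comment> \<open>Nested finite sets of equal cardinality coincide, so no block ends between
      \<open>i\<close> and \<open>j\<close>.\<close>
    have "B i \<subseteq> B j" using * by (auto simp: B_def)
    moreover have "card (B i) = card (B j)" using * c by (simp add: e_def inj_eq)
    ultimately have eq: "B i = B j" using card_subset_eq[OF fin] by blast
    have "k \<notin> B i" using * by (simp add: B_def)
    hence "k \<notin> B j" unfolding eq .
    thus "s k" using * by (simp add: B_def)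
  qed
  thus ?thesis using that by blast
qed

subsection \<open>Minimal and cyclic matrices\<close>

lemma commute_mult_mat:
  assumes X: "X \<in> carrier_mat n n" and Y: "Y \<in> carrier_mat n n" and W: "W \<in> carrier_mat n n"
    and XW: "X * W = W * X" and YW: "Y * W = W * Y"
  shows "X * Y * W = W * (X * Y)"
proof -
  have "X * Y * W = X * (W * Y)" unfolding assoc_mult_mat[OF X Y W] YW ..
  also have "\<dots> = W * X * Y" unfolding assoc_mult_mat[OF X W Y, symmetric] XW ..
  also have "\<dots> = W * (X * Y)" by (rule assoc_mult_mat[OF W X Y])
  finally show ?thesis .
qed

lemma commute_add_smult_mat:
  fixes X :: "'a::comm_ring_1 mat"
  assumes X: "X \<in> carrier_mat n n" and Y: "Y \<in> carrier_mat n n" and W: "W \<in> carrier_mat n n"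
    and XW: "X * W = W * X" and YW: "Y * W = W * Y"
  shows "(X + a \<cdot>\<^sub>m Y) * W = W * (X + a \<cdot>\<^sub>m Y)"
proof -
  have aY: "a \<cdot>\<^sub>m Y \<in> carrier_mat n n" using Y by simp
  have "(X + a \<cdot>\<^sub>m Y) * W = X * W + a \<cdot>\<^sub>m (Y * W)"
    unfolding add_mult_distrib_mat[OF X aY W] mult_smult_assoc_mat[OF Y W] ..
  also have "\<dots> = W * (X + a \<cdot>\<^sub>m Y)"
    unfolding XW YW mult_add_distrib_mat[OF W X aY] mult_smult_distrib[OF W Y] ..
  finally show ?thesis .
qed

lemma centralizer_matD: "X \<in> centralizer_mat n M \<Longrightarrow> X \<in> carrier_mat n n"
  "X \<in> centralizer_mat n M \<Longrightarrow> M * X = X * M"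
  by (auto simp: centralizer_mat_def)

lemma centralizer_mat_symI: "M \<in> carrier_mat n n \<Longrightarrow> X \<in> centralizer_mat n M \<Longrightarrow> M \<in> centralizer_mat n X"
  by (auto simp: centralizer_mat_def)

text \<open>If the centralizer of \<open>X\<close> lies in that of \<open>M\<close>, then
  \<open>X\<close> itself commutes with \<open>M\<close>; by commutativity everything that commutes
  with \<open>M\<close> then commutes with \<open>X\<close>.\<close>

lemma minimal_matI:
  assumes M: "M \<in> carrier_mat n n"
    and comm: "\<And>X Y. X \<in> centralizer_mat n M \<Longrightarrow> Y \<in> centralizer_mat n M \<Longrightarrow> X * Y = Y * X"
  shows "minimal_mat n M"
  unfolding minimal_mat_def
proof (intro conjI ballI impI M equalityI subsetI)
  fix X W assume X: "X \<in> carrier_mat n n" "centralizer_mat n X \<subseteq> centralizer_mat n M"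
  have XM: "X \<in> centralizer_mat n M" using X by (auto simp: centralizer_mat_def)
  {
    assume "W \<in> centralizer_mat n X"
    thus "W \<in> centralizer_mat n M" using X by blast
  next
    assume "W \<in> centralizer_mat n M"
    thus "W \<in> centralizer_mat n X" using comm[OF XM] by (auto simp: centralizer_mat_def)
  }
qed

text \<open>
  For a nonderogatory matrix the bicommutant consists of the polynomials in the matrix; using it
  instead of these polynomials makes the notion of a cyclic vector depend on the centralizer only.
\<close>

definition bicommutant_mat :: "nat \<Rightarrow> 'a::semiring_0 mat \<Rightarrow> 'a mat set" where
  "bicommutant_mat n M = {Z \<in> carrier_mat n n. \<forall>W\<in>centralizer_mat n M. Z * W = W * Z}"

definition cyclic_mat :: "nat \<Rightarrow> 'a::semiring_0 mat \<Rightarrow> bool" where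
  "cyclic_mat n M \<longleftrightarrow> M \<in> carrier_mat n n \<and>
     (\<exists>w\<in>carrier_vec n. \<forall>x\<in>carrier_vec n. \<exists>Z\<in>bicommutant_mat n M. Z *\<^sub>v w = x)"

lemma eq_mat_by_vec:
  fixes A B :: "'a::comm_ring_1 mat"
  assumes "A \<in> carrier_mat n n" "B \<in> carrier_mat n n"
    and "\<And>v. v \<in> carrier_vec n \<Longrightarrow> A *\<^sub>v v = B *\<^sub>v v"
  shows "A = B"
proof (rule eq_matI)
  fix i j assume "i < dim_row B" "j < dim_col B"
  hence ij: "i < n" "j < n" using assms(2) by auto
  have entry: "(X *\<^sub>v unit_vec n j) $ i = X $$ (i, j)" if X: "X \<in> carrier_mat n n" for X :: "'a mat"
  proof -
    have "(X *\<^sub>v unit_vec n j) $ i = row X i \<bullet> unit_vec n j" using X ij(1) by (intro index_mult_mat_vec) auto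
    also have "\<dots> = row X i $ j" using ij(2) X by (intro scalar_prod_right_unit) auto
    also have "\<dots> = X $$ (i, j)" using X ij by (intro index_row) auto
    finally show ?thesis .
  qed
  have "A *\<^sub>v unit_vec n j = B *\<^sub>v unit_vec n j" by (rule assms(3)) (rule unit_vec_carrier)
  thus "A $$ (i, j) = B $$ (i, j)" using entry[OF assms(1)] entry[OF assms(2)] by metis
qed (use assms(1,2) in auto)

text \<open>Choose \<open>Z\<close> in the bicommutant agreeing with \<open>W\<close> on the cyclic
  vector \<open>w\<close>. Both commute with every \<open>T\<close> of the bicommutant, hence agree
  on all vectors T w, that is, everywhere.\<close>

lemma cyclic_mat_centralizer:
  fixes M :: "'a::comm_ring_1 mat"
  assumes "cyclic_mat n M"
  shows "centralizer_mat n M \<subseteq> bicommutant_mat n M"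
proof
  fix W assume W: "W \<in> centralizer_mat n M"
  from assms obtain w where M: "M \<in> carrier_mat n n" and w: "w \<in> carrier_vec n"
    and cyc: "\<And>x. x \<in> carrier_vec n \<Longrightarrow> \<exists>Z\<in>bicommutant_mat n M. Z *\<^sub>v w = x"
    by (auto simp: cyclic_mat_def)
  have Wc: "W \<in> carrier_mat n n" using W by (rule centralizer_matD)
  obtain Z where Z: "Z \<in> bicommutant_mat n M" and Zw: "Z *\<^sub>v w = W *\<^sub>v w"
    using cyc[of "W *\<^sub>v w"] Wc w by auto
  have Zc: "Z \<in> carrier_mat n n" using Z by (simp add: bicommutant_mat_def)
  have "W = Z"
  proof (rule eq_mat_by_vec[OF Wc Zc])
    fix x :: "'a vec" assume "x \<in> carrier_vec n"
    then obtain T where T: "T \<in> bicommutant_mat n M" and Tw: "T *\<^sub>v w = x" using cyc by blast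
    have Tc: "T \<in> carrier_mat n n" using T by (simp add: bicommutant_mat_def)
    \<comment> \<open>Since \<open>M\<close> commutes with itself, the bicommutant lies in the
      centralizer, and so its elements commute with each other.\<close>
    have "M \<in> centralizer_mat n M" using M by (simp add: centralizer_mat_def)
    hence "T \<in> centralizer_mat n M" using T by (auto simp: bicommutant_mat_def centralizer_mat_def)
    hence ZT: "Z * T = T * Z" using Z by (simp add: bicommutant_mat_def)
    have TW: "T * W = W * T" using T W by (simp add: bicommutant_mat_def)
    have "W *\<^sub>v x = (W * T) *\<^sub>v w" using Wc Tc w Tw by (simp add: assoc_mult_mat_vec)
    also have "\<dots> = T *\<^sub>v (W *\<^sub>v w)" using Wc Tc w TW[symmetric] by (simp add: assoc_mult_mat_vec)
    also have "\<dots> = (T * Z) *\<^sub>v w" using Zc Tc w Zw by (simp add: assoc_mult_mat_vec)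
    also have "\<dots> = Z *\<^sub>v x" using Zc Tc w Tw ZT[symmetric] by (simp add: assoc_mult_mat_vec)
    finally show "W *\<^sub>v x = Z *\<^sub>v x" .
  qed
  thus "W \<in> bicommutant_mat n M" using Z by simp
qed

text \<open>The centralizer lies in the bicommutant and is therefore commutative.\<close>

lemma cyclic_mat_minimal:
  fixes M :: "'a::comm_ring_1 mat"
  assumes "cyclic_mat n M"
  shows "minimal_mat n M"
  using cyclic_mat_centralizer[OF assms] assms
  by (intro minimal_matI) (auto simp: cyclic_mat_def bicommutant_mat_def)

lemma separated_linked_mat_centralizer:
  fixes d :: "nat \<Rightarrow> 'a::field"
  assumes "separated_links n d s" "W \<in> centralizer_mat n (linked_mat n d s)"
    "i < n" "j < n" "d i \<noteq> d j"
  shows "W $$ (i, j) = 0"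
  using assms linked_mat_intertwine_zero[of n d s d s W i j]
  by (auto simp: centralizer_mat_def separated_links_def)

text \<open>The sum of the last basis vectors of all blocks is cyclic. Spectral projections extract
  the last vector of a single block, the nilpotent part moves it up through the block, and linear
  combinations give every vector; all operators used lie in the bicommutant.\<close>

lemma separated_linked_mat_cyclic:
  fixes d :: "nat \<Rightarrow> 'a::field"
  assumes sep: "separated_links n d s"
  shows "cyclic_mat n (linked_mat n d s)"
proof -
  let ?J = "linked_mat n d s" and ?N = "linked_mat n (\<lambda>_. 0 :: 'a) s"
  let ?BC = "bicommutant_mat n ?J"
  \<comment> \<open>The entry is 1 exactly at the last row of each block.\<close>
  define w :: "'a vec" where "w = vec n (\<lambda>i. if s i then 0 else 1)"
  have w: "w \<in> carrier_vec n" by (simp add: w_def)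
  have c: "compatible_links n d s" using sep by (simp add: separated_links_def)
  have lt: "s i \<Longrightarrow> Suc i < n" for i using c by (simp add: compatible_links_def)
  have W0: "d i * W $$ (i, j) = W $$ (i, j) * d j" if "W \<in> centralizer_mat n ?J" "i < n" "j < n" for W i j
    using separated_linked_mat_centralizer[OF sep that] by (cases "d i = d j") auto
  \<comment> \<open>\<open>?J\<close> and \<open>?N\<close> differ by the diagonal part, which
    commutes with \<open>W\<close> by \<open>W0\<close>.\<close>
  have N: "?N \<in> ?BC"
    unfolding bicommutant_mat_def
  proof (intro CollectI conjI ballI linked_mat_carrier)
    fix W assume W: "W \<in> centralizer_mat n ?J"
    note Wc = centralizer_matD(1)[OF W]
    show "?N * W = W * ?N"
    proof (rule eq_matI)
      fix i j assume "i < dim_row (W * ?N)" "j < dim_col (W * ?N)"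
      hence ij: "i < n" "j < n" using Wc by simp_all
      have "(?J * W) $$ (i, j) = (W * ?J) $$ (i, j)" using centralizer_matD(2)[OF W] by simp
      thus "(?N * W) $$ (i, j) = (W * ?N) $$ (i, j)" using ij lt W0[OF W ij] by (simp add: linked_mat_mult_left[OF Wc] linked_mat_mult_right[OF Wc])
    qed (use Wc in simp_all)
  qed
  have mult: "X * Y \<in> ?BC" if "X \<in> ?BC" "Y \<in> ?BC" for X Y
    unfolding bicommutant_mat_def
  proof (intro CollectI conjI ballI)
    have X: "X \<in> carrier_mat n n" and Y: "Y \<in> carrier_mat n n" using that by (auto simp: bicommutant_mat_def)
    thus "X * Y \<in> carrier_mat n n" by simp
    fix W assume W: "W \<in> centralizer_mat n ?J"
    note Wc = centralizer_matD(1)[OF W]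
    have XW: "X * W = W * X" and YW: "Y * W = W * Y" using that W by (auto simp: bicommutant_mat_def)
    show "X * Y * W = W * (X * Y)"
      by (rule commute_mult_mat[OF X Y Wc XW YW])
  qed
  have lin: "X + a \<cdot>\<^sub>m Y \<in> ?BC" if "X \<in> ?BC" "Y \<in> ?BC" for X Y a
    unfolding bicommutant_mat_def
  proof (intro CollectI conjI ballI)
    have X: "X \<in> carrier_mat n n" and Y: "Y \<in> carrier_mat n n" using that by (auto simp: bicommutant_mat_def)
    thus "X + a \<cdot>\<^sub>m Y \<in> carrier_mat n n" by simp
    fix W assume W: "W \<in> centralizer_mat n ?J"
    note Wc = centralizer_matD(1)[OF W]
    have XW: "X * W = W * X" and YW: "Y * W = W * Y" using that W by (auto simp: bicommutant_mat_def)
    show "(X + a \<cdot>\<^sub>m Y) * W = W * (X + a \<cdot>\<^sub>m Y)"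
      by (rule commute_add_smult_mat[OF X Y Wc XW YW])
  qed
  \<comment> \<open>Each block is climbed from its last row, where a projection of \<open>w\<close>
    is used; from there \<open>?N\<close> sends unit vector a + 1 to unit vector a.\<close>
  have unit: "\<exists>Z\<in>?BC. Z *\<^sub>v w = unit_vec n a" if "a < n" for a
    using that
  proof (induction "n - a" arbitrary: a rule: less_induct)
    case less
    show ?case
    proof (cases "s a")
      case True
      with lt obtain Z where Z: "Z \<in> ?BC" "Z *\<^sub>v w = unit_vec n (Suc a)"
        using less.hyps[of "Suc a"] less.prems by force
      have Zc: "Z \<in> carrier_mat n n" using Z by (simp add: bicommutant_mat_def)
      have "?N *\<^sub>v unit_vec n (Suc a) = unit_vec n a"
        by (rule eq_vecI) (use True lt[of a] less.prems in \<open>auto simp: linked_mat_def\<close>)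
      hence "(?N * Z) *\<^sub>v w = unit_vec n a"
        using Z w Zc by (simp add: assoc_mult_mat_vec[OF linked_mat_carrier Zc w])
      thus ?thesis using mult[OF N Z(1)] by blast
    next
      case False
      \<comment> \<open>This is the projection onto the generalized eigenspace of
        \<open>d a\<close>; by separation that space is spanned by the single block ending at
        \<open>a\<close>.\<close>
      define Z where "Z = mat n n (\<lambda>(i, j). if i = j \<and> d i = d a then 1 else 0 :: 'a)"
      have Zlink: "Z = linked_mat n (\<lambda>i. if d i = d a then 1 else 0) (\<lambda>_. False)"
        by (auto simp: Z_def linked_mat_def)
      have "Z \<in> ?BC"
        unfolding bicommutant_mat_def
      proof (intro CollectI conjI ballI)
        show "Z \<in> carrier_mat n n" by (simp add: Z_def)
        fix W assume W: "W \<in> centralizer_mat n ?J"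
        note Wc = centralizer_matD(1)[OF W]
        show "Z * W = W * Z"
        proof (rule eq_matI)
          fix i j assume "i < dim_row (W * Z)" "j < dim_col (W * Z)"
          hence ij: "i < n" "j < n" using Wc by (simp_all add: Z_def)
          show "(Z * W) $$ (i, j) = (W * Z) $$ (i, j)"
            unfolding Zlink using ij separated_linked_mat_centralizer[OF sep W ij]
            by (auto simp: linked_mat_mult_left[OF Wc] linked_mat_mult_right[OF Wc])
        qed (use Wc in \<open>simp_all add: Z_def\<close>)
      qed
      moreover have "Z *\<^sub>v w = unit_vec n a"
      proof (rule eq_vecI)
        fix i assume "i < dim_vec (unit_vec n a)"
        hence i: "i < n" by simp
        have "(Z *\<^sub>v w) $ i = (\<Sum>j<n. (if i = j \<and> d i = d a then 1 else 0) * w $ j)"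
          using i w by (simp add: Z_def scalar_prod_def atLeast0LessThan)
        also have "\<dots> = (\<Sum>j<n. if j = i then if d i = d a then w $ i else 0 else 0)"
          by (intro sum.cong) auto
        also have "\<dots> = (if d i = d a then w $ i else 0)" using i by simp
        also have "\<dots> = unit_vec n a $ i"
        proof (cases "d i = d a")
          case True
          \<comment> \<open>If \<open>i\<close> and \<open>a\<close> have equal eigenvalues,
            separation puts links on all rows between them. For \<open>i < a\<close> this makes
            \<open>w\<close> vanish at \<open>i\<close>; for \<open>a < i\<close> it contradicts the
            absence of a link at \<open>a\<close>.\<close>
          have "s i" if "i < a" using sep True that less.prems unfolding separated_links_def by blast
          moreover have "s a" if "a < i" using sep True that i unfolding separated_links_def
            by (metis order_refl)
          ultimately show ?thesis using False True i less.prems by (cases i a rule: linorder_cases) (auto simp: w_def)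
        qed (use i less.prems in auto)
        finally show "(Z *\<^sub>v w) $ i = unit_vec n a $ i" .
      qed (simp add: Z_def)
      ultimately show ?thesis by blast
    qed
  qed
  \<comment> \<open>Induction on the length \<open>k\<close> of the initial segment that contains
    the nonzero entries of \<open>x\<close>.\<close>
  have "\<exists>Z\<in>?BC. Z *\<^sub>v w = x" if "k \<le> n" "x \<in> carrier_vec n" "\<And>i. k \<le> i \<Longrightarrow> i < n \<Longrightarrow> x $ i = 0" for k x
    using that
  proof (induction k arbitrary: x)
    case 0
    have "0\<^sub>m n n \<in> ?BC" by (auto simp: bicommutant_mat_def centralizer_mat_def)
    moreover have "0\<^sub>m n n *\<^sub>v w = x" by (rule eq_vecI) (use 0 w in auto)
    ultimately show ?case by blast
  next
    case (Suc k)
    define y where "y = vec n (\<lambda>i. if i = k then 0 else x $ i)"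
    obtain Z where Z: "Z \<in> ?BC" "Z *\<^sub>v w = y"
      using Suc.IH[of y] Suc.prems by (force simp: y_def)
    obtain U where U: "U \<in> ?BC" "U *\<^sub>v w = unit_vec n k" using unit[of k] Suc.prems by auto
    have Zc: "Z \<in> carrier_mat n n" and Uc: "U \<in> carrier_mat n n"
      using Z U by (auto simp: bicommutant_mat_def)
    have "(Z + x $ k \<cdot>\<^sub>m U) *\<^sub>v w = y + x $ k \<cdot>\<^sub>v unit_vec n k"
    proof (rule eq_vecI)
      fix i assume "i < dim_vec (y + x $ k \<cdot>\<^sub>v unit_vec n k)"
      hence i: "i < n" by simp
      have "((Z + x $ k \<cdot>\<^sub>m U) *\<^sub>v w) $ i = (\<Sum>j<n. (Z $$ (i, j) + x $ k * U $$ (i, j)) * w $ j)"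
        using i Zc Uc w by (simp add: scalar_prod_def atLeast0LessThan)
      also have "\<dots> = (\<Sum>j<n. Z $$ (i, j) * w $ j) + x $ k * (\<Sum>j<n. U $$ (i, j) * w $ j)"
        by (simp add: distrib_right sum.distrib sum_distrib_left mult.assoc)
      also have "(\<Sum>j<n. Z $$ (i, j) * w $ j) = (Z *\<^sub>v w) $ i"
        using i Zc w by (simp add: scalar_prod_def atLeast0LessThan)
      also have "(\<Sum>j<n. U $$ (i, j) * w $ j) = (U *\<^sub>v w) $ i"
        using i Uc w by (simp add: scalar_prod_def atLeast0LessThan)
      finally show "((Z + x $ k \<cdot>\<^sub>m U) *\<^sub>v w) $ i = (y + x $ k \<cdot>\<^sub>v unit_vec n k) $ i"
        using i Z U by (simp add: y_def)
    qed (use Uc in simp)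
    also have "\<dots> = x" by (rule eq_vecI) (use Suc.prems in \<open>auto simp: y_def\<close>)
    finally show ?case using lin[OF Z(1) U(1)] by blast
  qed
  note span = this
  show ?thesis
    unfolding cyclic_mat_def
  proof (rule conjI, rule linked_mat_carrier, rule bexI[OF _ w], rule ballI)
    fix x :: "'a vec" assume x: "x \<in> carrier_vec n"
    show "\<exists>Z\<in>?BC. Z *\<^sub>v w = x" by (rule span[OF order_refl x]) simp
  qed
qed

subsection \<open>Conjugation\<close>

locale inverse_mats =
  fixes n :: nat and P Q :: "'a::field mat"
  assumes P: "P \<in> carrier_mat n n" and Q: "Q \<in> carrier_mat n n"
    and PQ: "P * Q = 1\<^sub>m n" and QP: "Q * P = 1\<^sub>m n"
begin

definition conj_mat :: "'a mat \<Rightarrow> 'a mat" where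
  "conj_mat X = P * X * Q"

lemma conj_mat_carrier [simp]: "X \<in> carrier_mat n n \<Longrightarrow> conj_mat X \<in> carrier_mat n n"
  using P Q by (simp add: conj_mat_def)

lemma conj_mat_mult:
  assumes X: "X \<in> carrier_mat n n" and Y: "Y \<in> carrier_mat n n"
  shows "conj_mat X * conj_mat Y = conj_mat (X * Y)"
proof -
  have "conj_mat X * conj_mat Y = P * X * (Q * (P * Y * Q))"
    unfolding conj_mat_def by (rule assoc_mult_mat) (use P Q X Y in auto)
  also have "Q * (P * Y * Q) = Q * P * (Y * Q)"
    using P Q Y by (simp add: assoc_mult_mat[of _ n n _ n _ n])
  also have "\<dots> = Y * Q" using QP Y Q by simp
  also have "P * X * (Y * Q) = conj_mat (X * Y)"
    unfolding conj_mat_def using P Q X Y by (simp add: assoc_mult_mat[of _ n n _ n _ n])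
  finally show ?thesis .
qed

lemma conj_mat_add_smult:
  assumes X: "X \<in> carrier_mat n n" and Y: "Y \<in> carrier_mat n n"
  shows "conj_mat (X + a \<cdot>\<^sub>m Y) = conj_mat X + a \<cdot>\<^sub>m conj_mat Y"
proof -
  have aY: "a \<cdot>\<^sub>m Y \<in> carrier_mat n n" using Y by simp
  have PX: "P * X \<in> carrier_mat n n" and PY: "P * Y \<in> carrier_mat n n"
    and aPY: "a \<cdot>\<^sub>m (P * Y) \<in> carrier_mat n n" using P X Y by auto
  show ?thesis
    unfolding conj_mat_def mult_add_distrib_mat[OF P X aY] mult_smult_distrib[OF P Y]
      add_mult_distrib_mat[OF PX aPY Q] mult_smult_assoc_mat[OF PY Q] ..
qed

lemma unconj_conj_mat:
  assumes X: "X \<in> carrier_mat n n"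
  shows "Q * conj_mat X * P = X"
proof -
  have "Q * conj_mat X * P = Q * P * X * (Q * P)"
    unfolding conj_mat_def using P Q X by (simp add: assoc_mult_mat[of _ n n _ n _ n])
  thus ?thesis using QP X by simp
qed

lemma conj_unconj_mat:
  assumes X: "X \<in> carrier_mat n n"
  shows "conj_mat (Q * X * P) = X"
proof -
  have "conj_mat (Q * X * P) = P * Q * X * (P * Q)"
    unfolding conj_mat_def using P Q X by (simp add: assoc_mult_mat[of _ n n _ n _ n])
  thus ?thesis using PQ X by simp
qed

lemma conj_mat_cases:
  assumes "Y \<in> carrier_mat n n"
  obtains X where "X \<in> carrier_mat n n" "Y = conj_mat X"
  using that[of "Q * Y * P"] conj_unconj_mat[OF assms] assms P Q by simp

lemma conj_mat_eq_iff:
  "X \<in> carrier_mat n n \<Longrightarrow> Y \<in> carrier_mat n n \<Longrightarrow> conj_mat X = conj_mat Y \<longleftrightarrow> X = Y"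
  by (metis unconj_conj_mat)

lemma conj_mat_commute_iff:
  assumes X: "X \<in> carrier_mat n n" and Y: "Y \<in> carrier_mat n n"
  shows "conj_mat X * conj_mat Y = conj_mat Y * conj_mat X \<longleftrightarrow> X * Y = Y * X"
  unfolding conj_mat_mult[OF X Y] conj_mat_mult[OF Y X]
  by (rule conj_mat_eq_iff) (use X Y in auto)

lemma centralizer_conj_mat:
  assumes M: "M \<in> carrier_mat n n"
  shows "centralizer_mat n (conj_mat M) = conj_mat ` centralizer_mat n M"
proof (intro equalityI subsetI)
  fix Y assume Y: "Y \<in> centralizer_mat n (conj_mat M)"
  obtain X where X: "X \<in> carrier_mat n n" "Y = conj_mat X"
    using conj_mat_cases centralizer_matD(1)[OF Y] by blast
  thus "Y \<in> conj_mat ` centralizer_mat n M"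
    using centralizer_matD(2)[OF Y] conj_mat_commute_iff[OF M X(1)] by (auto simp: centralizer_mat_def)
next
  fix Y assume "Y \<in> conj_mat ` centralizer_mat n M"
  then obtain X where X: "X \<in> centralizer_mat n M" "Y = conj_mat X" by blast
  show "Y \<in> centralizer_mat n (conj_mat M)"
    using X(2) centralizer_matD[OF X(1)] conj_mat_commute_iff[OF M, of X] by (simp add: centralizer_mat_def)
qed

lemma centralizer_conj_mat_subset_iff:
  assumes M: "M \<in> carrier_mat n n" and N: "N \<in> carrier_mat n n"
  shows "centralizer_mat n (conj_mat M) \<subseteq> centralizer_mat n (conj_mat N) \<longleftrightarrow>
    centralizer_mat n M \<subseteq> centralizer_mat n N"
proof -
  have "inj_on conj_mat (carrier_mat n n)" by (auto simp: inj_on_def conj_mat_eq_iff)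
  hence "conj_mat X \<in> conj_mat ` centralizer_mat n N \<longleftrightarrow> X \<in> centralizer_mat n N"
    if "X \<in> carrier_mat n n" for X
    using that by (rule inj_on_image_mem_iff) (auto simp: centralizer_mat_def)
  thus ?thesis
    unfolding centralizer_conj_mat[OF M] centralizer_conj_mat[OF N] image_subset_iff
    using centralizer_matD(1) by blast
qed

lemma minimal_conj_mat_iff:
  assumes M: "M \<in> carrier_mat n n"
  shows "minimal_mat n (conj_mat M) \<longleftrightarrow> minimal_mat n M"
proof
  assume min: "minimal_mat n (conj_mat M)"
  show "minimal_mat n M"
    unfolding minimal_mat_def
  proof (intro conjI M ballI impI)
    fix X assume X: "X \<in> carrier_mat n n" "centralizer_mat n X \<subseteq> centralizer_mat n M"
    hence "centralizer_mat n (conj_mat X) \<subseteq> centralizer_mat n (conj_mat M)"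
      using centralizer_conj_mat_subset_iff M by simp
    hence "centralizer_mat n (conj_mat M) \<subseteq> centralizer_mat n (conj_mat X)"
      using min X(1) unfolding minimal_mat_def by auto
    thus "centralizer_mat n X = centralizer_mat n M"
      using centralizer_conj_mat_subset_iff[OF M X(1)] X(2) by simp
  qed
next
  assume min: "minimal_mat n M"
  show "minimal_mat n (conj_mat M)"
    unfolding minimal_mat_def
  proof (intro conjI conj_mat_carrier M ballI impI)
    fix Y assume Y: "Y \<in> carrier_mat n n" "centralizer_mat n Y \<subseteq> centralizer_mat n (conj_mat M)"
    obtain X where X: "X \<in> carrier_mat n n" "Y = conj_mat X" using conj_mat_cases Y(1) by blast
    have "centralizer_mat n X \<subseteq> centralizer_mat n M"
      using centralizer_conj_mat_subset_iff[OF X(1) M] Y(2) X(2) by simp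
    hence "centralizer_mat n X = centralizer_mat n M" using min X(1) by (simp add: minimal_mat_def)
    thus "centralizer_mat n Y = centralizer_mat n (conj_mat M)"
      unfolding X(2) centralizer_conj_mat[OF M] centralizer_conj_mat[OF X(1)] by simp
  qed
qed

text \<open>Conjugation fixes every scalar matrix and is injective.\<close>

lemma scalar_conj_mat_iff:
  assumes M: "M \<in> carrier_mat n n"
  shows "conj_mat M \<in> scalar_matrices n \<longleftrightarrow> M \<in> scalar_matrices n"
proof -
  have "conj_mat (c \<cdot>\<^sub>m 1\<^sub>m n) = c \<cdot>\<^sub>m 1\<^sub>m n" for c
  proof -
    have "conj_mat (c \<cdot>\<^sub>m 1\<^sub>m n) = c \<cdot>\<^sub>m (P * 1\<^sub>m n) * Q"
      unfolding conj_mat_def mult_smult_distrib[OF P one_carrier_mat] ..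
    also have "\<dots> = c \<cdot>\<^sub>m 1\<^sub>m n" using P Q PQ by (simp add: mult_smult_assoc_mat[OF P Q])
    finally show ?thesis .
  qed
  thus ?thesis using conj_mat_eq_iff[OF M] unfolding scalar_matrices_def
    by (smt (verit, best) mem_Collect_eq one_carrier_mat smult_carrier_mat)
qed

text \<open>If \<open>w\<close> is cyclic for \<open>M\<close>, then P w is cyclic for the
  conjugate: the vector \<open>x\<close> is reached by the conjugate of a \<open>Z\<close> that
  sends \<open>w\<close> to Q x.\<close>

lemma cyclic_conj_mat:
  assumes "cyclic_mat n M"
  shows "cyclic_mat n (conj_mat M)"
proof -
  obtain w where M: "M \<in> carrier_mat n n" and w: "w \<in> carrier_vec n"
    and cyc: "\<And>x. x \<in> carrier_vec n \<Longrightarrow> \<exists>Z\<in>bicommutant_mat n M. Z *\<^sub>v w = x"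
    using assms by (auto simp: cyclic_mat_def)
  have Pw: "P *\<^sub>v w \<in> carrier_vec n" using P w by simp
  show ?thesis
    unfolding cyclic_mat_def
  proof (rule conjI, rule conj_mat_carrier[OF M], rule bexI[OF _ Pw], rule ballI)
    fix x :: "'a vec" assume x: "x \<in> carrier_vec n"
    obtain Z where Z: "Z \<in> bicommutant_mat n M" and Zw: "Z *\<^sub>v w = Q *\<^sub>v x"
      using cyc[of "Q *\<^sub>v x"] Q x by auto
    have Zc: "Z \<in> carrier_mat n n" using Z by (simp add: bicommutant_mat_def)
    have "conj_mat Z \<in> bicommutant_mat n (conj_mat M)"
      unfolding bicommutant_mat_def centralizer_conj_mat[OF M]
    proof (intro CollectI conjI ballI conj_mat_carrier Zc)
      fix W assume "W \<in> conj_mat ` centralizer_mat n M"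
      then obtain V where V: "V \<in> centralizer_mat n M" "W = conj_mat V" by blast
      have "Z * V = V * Z" using Z V by (simp add: bicommutant_mat_def)
      thus "conj_mat Z * W = W * conj_mat Z"
        unfolding V(2) conj_mat_commute_iff[OF Zc centralizer_matD(1)[OF V(1)]] .
    qed
    moreover have "conj_mat Z *\<^sub>v (P *\<^sub>v w) = x"
    proof -
      have "conj_mat Z *\<^sub>v (P *\<^sub>v w) = (P * Z) *\<^sub>v (Q *\<^sub>v (P *\<^sub>v w))"
        unfolding conj_mat_def using P Q Zc Pw by (intro assoc_mult_mat_vec) auto
      also have "Q *\<^sub>v (P *\<^sub>v w) = w" using QP w by (simp add: assoc_mult_mat_vec[OF Q P w, symmetric])
      also have "(P * Z) *\<^sub>v w = P *\<^sub>v (Q *\<^sub>v x)" unfolding Zw[symmetric] by (rule assoc_mult_mat_vec[OF P Zc w])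
      also have "\<dots> = x" using PQ x by (simp add: assoc_mult_mat_vec[OF P Q x, symmetric])
      finally show ?thesis .
    qed
    ultimately show "\<exists>Y\<in>bicommutant_mat n (conj_mat M). Y *\<^sub>v (P *\<^sub>v w) = x" by blast
  qed
qed

end

section \<open>Jordan bases and the characterization of minimal matrices\<close>

lemma similar_mat_inverse_mats:
  fixes A B :: "'a::field mat"
  assumes "similar_mat A B" "A \<in> carrier_mat n n"
  obtains P Q where "inverse_mats n P Q" "B \<in> carrier_mat n n" "A = inverse_mats.conj_mat P Q B"
proof -
  obtain P Q where "similar_mat_wit A B P Q" using assms(1) by (auto simp: similar_mat_def)
  note wit = similar_mat_witD2[OF assms(2) this]
  have inv: "inverse_mats n P Q" by unfold_locales (use wit in auto)
  show ?thesis by (rule that[OF inv wit(5)]) (simp add: wit(3) inverse_mats.conj_mat_def[OF inv])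
qed

lemma exists_linked_conj:
  fixes A :: "'a::alg_closed_field mat"
  assumes A: "A \<in> carrier_mat n n"
  obtains P Q d s where "inverse_mats n P Q" "compatible_links n d s"
    "A = inverse_mats.conj_mat P Q (linked_mat n d s)"
proof -
  obtain n_as where sim: "similar_mat A (jordan_matrix n_as)" using similar_jordan_matrix[OF A] by blast
  obtain P Q where inv: "inverse_mats n P Q" and J: "jordan_matrix n_as \<in> carrier_mat n n"
    and AJ: "A = inverse_mats.conj_mat P Q (jordan_matrix n_as)"
    using similar_mat_inverse_mats[OF sim A] by blast
  have "sum_list (map fst n_as) = n" using J jordan_matrix_dim(1)[of n_as] by auto
  thus ?thesis using that inv AJ jordan_matrix_linked[of n_as] by metis
qed

text \<open>In a Jordan basis of \<open>A\<close> keep the links and replace the eigenvalues by ones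
  that separate the blocks; linked matrices with the same links commute.\<close>

lemma exists_commuting_separated:
  fixes A :: "'a::alg_closed_field mat"
  assumes A: "A \<in> carrier_mat n n"
  obtains P Q d s where "inverse_mats n P Q" "separated_links n d s"
    "inverse_mats.conj_mat P Q (linked_mat n d s) \<in> centralizer_mat n A"
proof -
  obtain P Q d s where inv: "inverse_mats n P Q" and c: "compatible_links n d s"
    and AJ: "A = inverse_mats.conj_mat P Q (linked_mat n d s)"
    using exists_linked_conj[OF A] by blast
  interpret inverse_mats n P Q by (rule inv)
  obtain e :: "nat \<Rightarrow> 'a" where e: "separated_links n e s" using exists_separated_links[OF c] by blast
  hence "linked_mat n d s * linked_mat n e s = linked_mat n e s * linked_mat n d s"
    using linked_mat_commute[OF c] by (simp add: separated_links_def)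
  hence "linked_mat n e s \<in> centralizer_mat n (linked_mat n d s)" by (simp add: centralizer_mat_def)
  hence "conj_mat (linked_mat n e s) \<in> centralizer_mat n A"
    unfolding AJ centralizer_conj_mat[OF linked_mat_carrier] by (rule imageI)
  thus ?thesis using that inv e by blast
qed

lemma exists_commuting_cyclic:
  fixes A :: "'a::alg_closed_field mat"
  assumes "A \<in> carrier_mat n n"
  obtains M where "cyclic_mat n M" "M \<in> centralizer_mat n A"
  using exists_commuting_separated[OF assms] inverse_mats.cyclic_conj_mat separated_linked_mat_cyclic
  by metis

text \<open>A separated Jordan matrix commuting with \<open>M\<close> is cyclic, so its centralizer
  is commutative. As \<open>M\<close> belongs to it, it is contained in the centralizer of
  \<open>M\<close>, and minimality turns this into equality.\<close>

lemma minimal_mat_separated: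
  fixes M :: "'a::alg_closed_field mat"
  assumes min: "minimal_mat n M"
  obtains P Q d s where "inverse_mats n P Q" "separated_links n d s"
    "centralizer_mat n M = centralizer_mat n (inverse_mats.conj_mat P Q (linked_mat n d s))"
proof -
  have M: "M \<in> carrier_mat n n" using min by (simp add: minimal_mat_def)
  obtain P Q d s where inv: "inverse_mats n P Q" and sep: "separated_links n d s"
    and J: "inverse_mats.conj_mat P Q (linked_mat n d s) \<in> centralizer_mat n M" (is "?J \<in> _")
    using exists_commuting_separated[OF M] by blast
  have cyc: "cyclic_mat n ?J"
    by (rule inverse_mats.cyclic_conj_mat[OF inv separated_linked_mat_cyclic[OF sep]])
  have "M \<in> centralizer_mat n ?J" by (rule centralizer_mat_symI[OF M J])
  hence "M * W = W * M" if "W \<in> centralizer_mat n ?J" for W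
    using cyclic_mat_centralizer[OF cyc] that by (auto simp: bicommutant_mat_def)
  hence "centralizer_mat n ?J \<subseteq> centralizer_mat n M" by (auto simp: centralizer_mat_def)
  moreover have "?J \<in> carrier_mat n n" using J by (rule centralizer_matD)
  ultimately have "centralizer_mat n M = centralizer_mat n ?J" using min unfolding minimal_mat_def by metis
  thus ?thesis using that inv sep by blast
qed

text \<open>A minimal matrix shares its centralizer with a cyclic one, and having a cyclic vector
  depends on the centralizer only.\<close>

lemma minimal_mat_iff_cyclic_mat:
  fixes M :: "'a::alg_closed_field mat"
  shows "minimal_mat n M \<longleftrightarrow> cyclic_mat n M"
proof
  assume min: "minimal_mat n M"
  obtain P Q d s where inv: "inverse_mats n P Q" and sep: "separated_links n d s"
    and eq: "centralizer_mat n M = centralizer_mat n (inverse_mats.conj_mat P Q (linked_mat n d s))"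
    using minimal_mat_separated[OF min] by blast
  have "cyclic_mat n (inverse_mats.conj_mat P Q (linked_mat n d s))"
    by (rule inverse_mats.cyclic_conj_mat[OF inv separated_linked_mat_cyclic[OF sep]])
  thus "cyclic_mat n M"
    using min unfolding cyclic_mat_def bicommutant_mat_def eq minimal_mat_def by simp
qed (rule cyclic_mat_minimal)

subsection \<open>An obstruction to minimality\<close>

definition elementary_mat :: "nat \<Rightarrow> nat \<Rightarrow> nat \<Rightarrow> 'a::semiring_1 mat" where
  "elementary_mat n f l = mat n n (\<lambda>(i, j). if i = f \<and> j = l then 1 else 0)"

lemma elementary_mat_carrier [simp]: "elementary_mat n f l \<in> carrier_mat n n"
  by (simp add: elementary_mat_def)

lemma elementary_mat_mult_left:
  fixes Z :: "'a::field mat"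
  assumes "Z \<in> carrier_mat n n" "i < n" "j < n" "l < n"
  shows "(elementary_mat n f l * Z) $$ (i, j) = (if i = f then Z $$ (l, j) else 0)"
proof -
  have "(elementary_mat n f l * Z) $$ (i, j) = (\<Sum>k<n. elementary_mat n f l $$ (i, k) * Z $$ (k, j))"
    using assms by (simp add: elementary_mat_def scalar_prod_def atLeast0LessThan)
  also have "\<dots> = (\<Sum>k<n. if k = l then if i = f then Z $$ (l, j) else 0 else 0)"
    using assms by (intro sum.cong) (auto simp: elementary_mat_def)
  finally show ?thesis using assms by simp
qed

lemma elementary_mat_mult_right:
  fixes Z :: "'a::field mat"
  assumes "Z \<in> carrier_mat n n" "i < n" "j < n" "f < n"
  shows "(Z * elementary_mat n f l) $$ (i, j) = (if j = l then Z $$ (i, f) else 0)"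
proof -
  have "(Z * elementary_mat n f l) $$ (i, j) = (\<Sum>k<n. Z $$ (i, k) * elementary_mat n f l $$ (k, j))"
    using assms by (simp add: elementary_mat_def scalar_prod_def atLeast0LessThan)
  also have "\<dots> = (\<Sum>k<n. if k = f then if j = l then Z $$ (i, f) else 0 else 0)"
    using assms by (intro sum.cong) (auto simp: elementary_mat_def)
  finally show ?thesis using assms by simp
qed

text \<open>\<open>f\<close> may coincide with \<open>l\<close> or \<open>m\<close>: the case
  \<open>f = l\<close> serves to exclude scalar matrices.\<close>

lemma not_minimal_mat_if_elementary:
  fixes M :: "'a::alg_closed_field mat"
  assumes min: "minimal_mat n M"
    and flm: "f < n" "l < n" "m < n" "l \<noteq> m"
    and comm: "elementary_mat n f l \<in> centralizer_mat n M" "elementary_mat n f m \<in> centralizer_mat n M"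
  shows False
proof -
  obtain w where w: "w \<in> carrier_vec n"
    and cyc: "\<And>x. x \<in> carrier_vec n \<Longrightarrow> \<exists>Z\<in>bicommutant_mat n M. Z *\<^sub>v w = x"
    using min by (auto simp: minimal_mat_iff_cyclic_mat cyclic_mat_def)
  \<comment> \<open>The functionals \<open>l\<close> and \<open>m\<close> are left eigenvectors of every \<open>Z\<close> in the bicommutant, with the same
    eigenvalue; hence they are proportional on the cyclic vector's orbit.\<close>
  have row: "(Z *\<^sub>v w) $ k = Z $$ (f, f) * w $ k"
    if Z: "Z \<in> bicommutant_mat n M" and k: "k < n" "elementary_mat n f k \<in> centralizer_mat n M" for Z k
  proof -
    have Zc: "Z \<in> carrier_mat n n" using Z by (simp add: bicommutant_mat_def)
    have eq: "Z * elementary_mat n f k = elementary_mat n f k * Z"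
      using Z k by (simp add: bicommutant_mat_def)
    \<comment> \<open>Comparing row \<open>f\<close> in the commutation relation shows that row
      \<open>k\<close> of \<open>Z\<close> is Z_ff times the unit row \<open>k\<close>.\<close>
    have Zk: "Z $$ (k, j) = (if j = k then Z $$ (f, f) else 0)" if "j < n" for j
    proof -
      have "Z $$ (k, j) = (elementary_mat n f k * Z) $$ (f, j)"
        using elementary_mat_mult_left[OF Zc flm(1) that k(1)] by simp
      also have "\<dots> = (if j = k then Z $$ (f, f) else 0)"
        unfolding eq[symmetric] by (rule elementary_mat_mult_right[OF Zc flm(1) that flm(1)])
      finally show ?thesis .
    qed
    have "(Z *\<^sub>v w) $ k = (\<Sum>j<n. Z $$ (k, j) * w $ j)"
      using Zc k w by (simp add: scalar_prod_def atLeast0LessThan)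
    also have "\<dots> = (\<Sum>j<n. if j = k then Z $$ (f, f) * w $ k else 0)"
      by (intro sum.cong) (auto simp: Zk)
    finally show ?thesis using k by simp
  qed
  obtain Z where Z: "Z \<in> bicommutant_mat n M" "Z *\<^sub>v w = unit_vec n l" using cyc[of "unit_vec n l"] by auto
  obtain U where U: "U \<in> bicommutant_mat n M" "U *\<^sub>v w = unit_vec n m" using cyc[of "unit_vec n m"] by auto
  \<comment> \<open>Reaching unit vector \<open>l\<close> forces Z_ff to be nonzero and hence w_m =
    0, whereas reaching unit vector \<open>m\<close> needs w_m to be nonzero.\<close>
  have 1: "Z $$ (f, f) * w $ l = 1" "Z $$ (f, f) * w $ m = 0"
    using row[OF Z(1) flm(2) comm(1)] row[OF Z(1) flm(3) comm(2)] Z(2) flm by simp_all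
  have 2: "U $$ (f, f) * w $ m = 1"
    using row[OF U(1) flm(3) comm(2)] U(2) flm by simp
  from 1 2 show False by auto
qed

lemma conj_elementary_not_minimal:
  fixes M :: "'a::alg_closed_field mat"
  assumes inv: "inverse_mats n P Q" and min: "minimal_mat n M"
    and flm: "f < n" "l < n" "m < n" "l \<noteq> m"
    and comm: "inverse_mats.conj_mat P Q (elementary_mat n f l) \<in> centralizer_mat n M"
      "inverse_mats.conj_mat P Q (elementary_mat n f m) \<in> centralizer_mat n M"
  shows False
proof -
  interpret inverse_mats n P Q by (rule inv)
  have "M \<in> carrier_mat n n" using min by (simp add: minimal_mat_def)
  then obtain N where N: "N \<in> carrier_mat n n" and MN: "M = conj_mat N" using conj_mat_cases by blast
  have "elementary_mat n f k \<in> centralizer_mat n N" if "conj_mat (elementary_mat n f k) \<in> centralizer_mat n M" for k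
    using centralizer_matD(2)[OF that] conj_mat_commute_iff[OF N elementary_mat_carrier]
    unfolding MN centralizer_mat_def by simp
  moreover have "minimal_mat n N" using min minimal_conj_mat_iff[OF N] by (simp add: MN)
  ultimately show False using not_minimal_mat_if_elementary[OF _ flm] comm by blast
qed

subsection \<open>Generic combinations of commuting matrices\<close>

text \<open>The equation makes \<open>Z\<close> an eigenvector, or zero, of the commutator map with
  \<open>Y\<close> for the value \<open>d\<close>. In a Jordan basis of \<open>Y\<close> it
  intertwines the Jordan matrix with its shift by \<open>d\<close>, which forces zero unless
  \<open>d\<close> is a difference of eigenvalues of \<open>Y\<close>.\<close>

lemma finite_ad_eigenvalues:
  fixes Y :: "'a::alg_closed_field mat"
  assumes Y: "Y \<in> carrier_mat n n"
  obtains S where "finite S"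
    "\<And>d Z. d \<notin> S \<Longrightarrow> Z \<in> carrier_mat n n \<Longrightarrow> Y * Z = Z * Y + d \<cdot>\<^sub>m Z \<Longrightarrow> Z = 0\<^sub>m n n"
proof -
  obtain P Q lam s where inv: "inverse_mats n P Q" and c: "compatible_links n lam s"
    and YJ: "Y = inverse_mats.conj_mat P Q (linked_mat n lam s)"
    using exists_linked_conj[OF Y] by blast
  interpret inverse_mats n P Q by (rule inv)
  let ?J = "linked_mat n lam s"
  define S where "S = (\<lambda>(i, j). lam i - lam j) ` ({..<n} \<times> {..<n})"
  show ?thesis
  proof (rule that[of S])
    show "finite S" by (simp add: S_def)
    fix d Z assume d: "d \<notin> S" and Zc: "Z \<in> carrier_mat n n" and eq: "Y * Z = Z * Y + d \<cdot>\<^sub>m Z"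
    obtain V where V: "V \<in> carrier_mat n n" and ZV: "Z = conj_mat V" using conj_mat_cases[OF Zc] by blast
    have VJ: "V * ?J \<in> carrier_mat n n" using mult_carrier_mat[OF V linked_mat_carrier] .
    have "conj_mat (?J * V) = conj_mat (V * ?J + d \<cdot>\<^sub>m V)"
      using eq unfolding YJ ZV conj_mat_mult[OF linked_mat_carrier V] conj_mat_mult[OF V linked_mat_carrier]
        conj_mat_add_smult[OF VJ V] .
    hence "?J * V = V * ?J + d \<cdot>\<^sub>m V"
      by (subst (asm) conj_mat_eq_iff) (use mult_carrier_mat[OF linked_mat_carrier V] VJ V in auto)
    \<comment> \<open>The scalar term is absorbed into the diagonal of the right factor, giving an
      intertwining relation with the same links.\<close>
    also have "\<dots> = V * linked_mat n (\<lambda>i. lam i + d) s"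
    proof (rule eq_matI)
      fix i j assume "i < dim_row (V * linked_mat n (\<lambda>i. lam i + d) s)" "j < dim_col (V * linked_mat n (\<lambda>i. lam i + d) s)"
      hence ij: "i < n" "j < n" using V by auto
      have "(V * ?J + d \<cdot>\<^sub>m V) $$ (i, j) = (V * ?J) $$ (i, j) + d * V $$ (i, j)"
        using V ij by (simp del: index_mult_mat(1))
      thus "(V * ?J + d \<cdot>\<^sub>m V) $$ (i, j) = (V * linked_mat n (\<lambda>i. lam i + d) s) $$ (i, j)"
        unfolding linked_mat_mult_right[OF V ij] by (simp add: algebra_simps)
    qed (use V in auto)
    finally have eqJ: "?J * V = V * linked_mat n (\<lambda>i. lam i + d) s" .
    have c': "compatible_links n (\<lambda>i. lam i + d) s" using c by (simp add: compatible_links_def)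
    have V0: "V $$ (i, j) = 0" if ij: "i < n" "j < n" for i j
    proof (rule linked_mat_intertwine_zero[OF c c' V eqJ ij])
      have "lam i - lam j \<in> S" unfolding S_def using ij by force
      thus "lam i \<noteq> lam j + d" using d by auto
    qed
    have "V = 0\<^sub>m n n" by (rule eq_matI) (use V V0 in auto)
    thus "Z = 0\<^sub>m n n" unfolding ZV conj_mat_def using P Q by simp
  qed
qed

text \<open>Take T = Y + c X. If \<open>M\<close> commutes with \<open>T\<close>, split
  \<open>M\<close> into weight components for the commutator with \<open>X\<close>. Those of nonzero
  weight are eigenvectors, or zero, of the commutator with \<open>Y\<close> for values proportional
  to \<open>c\<close>, and a generic \<open>c\<close> avoids all eigenvalues. Hence \<open>M\<close>
  commutes with \<open>X\<close>, and then with \<open>Y\<close>.\<close>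

lemma exists_generic_combination:
  fixes X Y :: "'a::alg_closed_field mat"
  assumes X: "X \<in> carrier_mat n n" and Y: "Y \<in> carrier_mat n n" and diag: "diagonal_mat X"
    and XY: "X * Y = Y * X"
  obtains T where "T \<in> carrier_mat n n"
    "centralizer_mat n T \<subseteq> centralizer_mat n X \<inter> centralizer_mat n Y"
proof -
  define D where "D i = X $$ (i, i)" for i
  have XD: "X = linked_mat n D (\<lambda>_. False)"
    by (rule eq_matI) (use X diag in \<open>auto simp: linked_mat_def D_def diagonal_mat_def\<close>)
  have Xl: "(X * Z) $$ (i, j) = D i * Z $$ (i, j)" if "Z \<in> carrier_mat n n" "i < n" "j < n" for Z i j
    using linked_mat_mult_left[OF that, of "\<lambda>_. False" D] by (simp add: XD)
  have Xr: "(Z * X) $$ (i, j) = Z $$ (i, j) * D j" if "Z \<in> carrier_mat n n" "i < n" "j < n" for Z i j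
    using linked_mat_mult_right[OF that, of D "\<lambda>_. False"] by (simp add: XD)
  have Y0: "Y $$ (i, j) = 0" if "i < n" "j < n" "D i \<noteq> D j" for i j
    using Xl[OF Y that(1,2)] Xr[OF Y that(1,2)] that(3) XY by (simp add: mult.commute)
  obtain S where S: "finite S"
    "\<And>d Z. d \<notin> S \<Longrightarrow> Z \<in> carrier_mat n n \<Longrightarrow> Y * Z = Z * Y + d \<cdot>\<^sub>m Z \<Longrightarrow> Z = 0\<^sub>m n n"
    using finite_ad_eigenvalues[OF Y] by blast
  \<comment> \<open>The excluded \<open>c\<close> are those putting some c (D j - D i) into
    \<open>S\<close>. When \<open>D i = D j\<close> the quotient is 0 by convention, which can only
    exclude \<open>c = 0\<close> in addition.\<close>
  have "finite ((\<lambda>(t, i, j). t / (D j - D i)) ` (S \<times> {..<n} \<times> {..<n}))" (is "finite ?bad") using S(1) by simp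
  then obtain c where c: "c \<notin> ?bad" using ex_new_if_finite[OF infinite_UNIV_alg_closed] by blast
  have cS: "c * (D j - D i) \<notin> S" if "i < n" "j < n" "D i \<noteq> D j" for i j
  proof
    assume "c * (D j - D i) \<in> S"
    moreover have "c = c * (D j - D i) / (D j - D i)" using that(3) by simp
    ultimately have "c \<in> ?bad" using that(1,2) by (intro image_eqI[of _ _ "(c * (D j - D i), i, j)"]) auto
    thus False using c by simp
  qed
  define T where "T = Y + c \<cdot>\<^sub>m X"
  have T: "T \<in> carrier_mat n n" using X Y by (simp add: T_def)
  have "M \<in> centralizer_mat n X \<inter> centralizer_mat n Y" if M: "M \<in> centralizer_mat n T" for M
  proof -
    note Mc = centralizer_matD(1)[OF M]
    have cX: "c \<cdot>\<^sub>m X \<in> carrier_mat n n" using X by simp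
    have eqm: "Y * M + c \<cdot>\<^sub>m (X * M) = M * Y + c \<cdot>\<^sub>m (M * X)"
      using centralizer_matD(2)[OF M]
      unfolding T_def add_mult_distrib_mat[OF Y cX Mc] mult_add_distrib_mat[OF Mc Y cX]
        mult_smult_assoc_mat[OF X Mc] mult_smult_distrib[OF Mc X] .
    have eq: "(Y * M) $$ (i, j) = (M * Y) $$ (i, j) + c * (D j - D i) * M $$ (i, j)" if ij: "i < n" "j < n" for i j
    proof -
      have "(Y * M + c \<cdot>\<^sub>m (X * M)) $$ (i, j) = (Y * M) $$ (i, j) + c * (X * M) $$ (i, j)"
        "(M * Y + c \<cdot>\<^sub>m (M * X)) $$ (i, j) = (M * Y) $$ (i, j) + c * (M * X) $$ (i, j)"
        using X Y Mc ij by (simp_all del: index_mult_mat(1))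
      thus ?thesis using eqm unfolding Xl[OF Mc ij] Xr[OF Mc ij] by (simp add: algebra_simps)
    qed
    have M0: "M $$ (a, b) = 0" if ab: "a < n" "b < n" "D a \<noteq> D b" for a b
    proof -
      \<comment> \<open>The component of \<open>M\<close> of weight \<open>D a - D b\<close> for the adjoint action of \<open>X\<close>: since \<open>Y\<close> preserves
        weights, it is an eigenvector of the adjoint action of \<open>Y\<close>.\<close>
      define N where "N = mat n n (\<lambda>(i, j). if D i - D j = D a - D b then M $$ (i, j) else 0)"
      have N: "N \<in> carrier_mat n n" by (simp add: N_def)
      have "Y * N = N * Y + (c * (D b - D a)) \<cdot>\<^sub>m N"
      proof (rule eq_matI)
        fix i j assume "i < dim_row (N * Y + (c * (D b - D a)) \<cdot>\<^sub>m N)" "j < dim_col (N * Y + (c * (D b - D a)) \<cdot>\<^sub>m N)"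
        hence ij: "i < n" "j < n" by (simp_all add: N_def)
        have "(Y * N) $$ (i, j) = (\<Sum>k<n. Y $$ (i, k) * N $$ (k, j))"
          using Y N ij by (simp add: scalar_prod_def atLeast0LessThan)
        \<comment> \<open>A nonzero Y_ik requires \<open>D i = D k\<close>, so (k, j) and (i, j)
          have the same weight and the filter leaves the sum.\<close>
        also have "\<dots> = (\<Sum>k<n. if D i - D j = D a - D b then Y $$ (i, k) * M $$ (k, j) else 0)"
        proof (rule sum.cong[OF refl])
          fix k assume "k \<in> {..<n}"
          thus "Y $$ (i, k) * N $$ (k, j) = (if D i - D j = D a - D b then Y $$ (i, k) * M $$ (k, j) else 0)"
            using Y0[of i k] ij by (cases "D i = D k") (auto simp: N_def)
        qed
        also have "\<dots> = (if D i - D j = D a - D b then (Y * M) $$ (i, j) else 0)"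
          using Y Mc ij by (simp add: scalar_prod_def atLeast0LessThan)
        finally have 1: "(Y * N) $$ (i, j) = (if D i - D j = D a - D b then (Y * M) $$ (i, j) else 0)" .
        have "(N * Y) $$ (i, j) = (\<Sum>k<n. N $$ (i, k) * Y $$ (k, j))"
          using Y N ij by (simp add: scalar_prod_def atLeast0LessThan)
        also have "\<dots> = (\<Sum>k<n. if D i - D j = D a - D b then M $$ (i, k) * Y $$ (k, j) else 0)"
        proof (rule sum.cong[OF refl])
          fix k assume "k \<in> {..<n}"
          thus "N $$ (i, k) * Y $$ (k, j) = (if D i - D j = D a - D b then M $$ (i, k) * Y $$ (k, j) else 0)"
            using Y0[of k j] ij by (cases "D k = D j") (auto simp: N_def)
        qed
        also have "\<dots> = (if D i - D j = D a - D b then (M * Y) $$ (i, j) else 0)"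
          using Y Mc ij by (simp add: scalar_prod_def atLeast0LessThan)
        finally have 2: "(N * Y) $$ (i, j) = (if D i - D j = D a - D b then (M * Y) $$ (i, j) else 0)" .
        have 3: "D j - D i = D b - D a" if "D i - D j = D a - D b"
          using that by (metis minus_diff_eq)
        have "(N * Y + (c * (D b - D a)) \<cdot>\<^sub>m N) $$ (i, j) = (N * Y) $$ (i, j) + c * (D b - D a) * N $$ (i, j)"
          using N Y ij by (simp del: index_mult_mat(1))
        thus "(Y * N) $$ (i, j) = (N * Y + (c * (D b - D a)) \<cdot>\<^sub>m N) $$ (i, j)"
          unfolding 1 2 using eq[OF ij] 3 ij by (simp add: N_def del: index_mult_mat(1))
      qed (use Y in \<open>auto simp: N_def\<close>)
      hence "N = 0\<^sub>m n n" using S(2)[OF cS[OF ab] N] by blast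
      hence "N $$ (a, b) = 0" using ab by simp
      thus ?thesis using ab by (simp add: N_def)
    qed
    have "X * M = M * X"
    proof (rule eq_matI)
      fix i j assume "i < dim_row (M * X)" "j < dim_col (M * X)"
      hence ij: "i < n" "j < n" using X Mc by auto
      show "(X * M) $$ (i, j) = (M * X) $$ (i, j)"
        unfolding Xl[OF Mc ij] Xr[OF Mc ij] using M0[OF ij] by (cases "D i = D j") auto
    qed (use X Mc in auto)
    moreover have "Y * M = M * Y"
    proof (rule eq_matI)
      fix i j assume "i < dim_row (M * Y)" "j < dim_col (M * Y)"
      hence ij: "i < n" "j < n" using Y Mc by auto
      show "(Y * M) $$ (i, j) = (M * Y) $$ (i, j)"
        unfolding eq[OF ij] using M0[OF ij] by (cases "D i = D j") auto
    qed (use Y Mc in auto)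
    ultimately show ?thesis using Mc by (simp add: centralizer_mat_def)
  qed
  thus ?thesis using that[OF T] by blast
qed

subsection \<open>The commuting graph\<close>

text \<open>Every matrix commutes with a scalar one, in particular the matrix units E_00 and
  E_01.\<close>

lemma minimal_mat_not_scalar:
  fixes M :: "'a::alg_closed_field mat"
  assumes min: "minimal_mat n M" and n: "n \<ge> 2"
  shows "M \<notin> scalar_matrices n"
proof
  assume "M \<in> scalar_matrices n"
  then obtain c where c: "M = c \<cdot>\<^sub>m 1\<^sub>m n" by (auto simp: scalar_matrices_def)
  have "W \<in> centralizer_mat n M" if W: "W \<in> carrier_mat n n" for W
    unfolding c centralizer_mat_def
    using W by (simp add: mult_smult_assoc_mat[of _ n n _ n] mult_smult_distrib[of _ n n _ n])
  thus False using not_minimal_mat_if_elementary[OF min, of 0 0 1] n by simp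
qed

lemma centralizer_mat_add_smult_one:
  fixes M :: "'a::comm_ring_1 mat"
  assumes M: "M \<in> carrier_mat n n"
  shows "centralizer_mat n (M + c \<cdot>\<^sub>m 1\<^sub>m n) = centralizer_mat n M"
proof -
  have sub: "centralizer_mat n N \<subseteq> centralizer_mat n (N + a \<cdot>\<^sub>m 1\<^sub>m n)" if N: "N \<in> carrier_mat n n" for N and a :: 'a
  proof
    fix W assume W: "W \<in> centralizer_mat n N"
    note Wc = centralizer_matD(1)[OF W]
    have "(N + a \<cdot>\<^sub>m 1\<^sub>m n) * W = W * (N + a \<cdot>\<^sub>m 1\<^sub>m n)"
      by (rule commute_add_smult_mat[OF N one_carrier_mat Wc centralizer_matD(2)[OF W]]) (use Wc in simp)
    thus "W \<in> centralizer_mat n (N + a \<cdot>\<^sub>m 1\<^sub>m n)" using Wc by (simp add: centralizer_mat_def)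
  qed
  \<comment> \<open>Shifting back by \<open>- c\<close> turns the one inclusion into an
    equality.\<close>
  have "M = M + c \<cdot>\<^sub>m 1\<^sub>m n + (- c) \<cdot>\<^sub>m 1\<^sub>m n" by (rule eq_matI) (use M in auto)
  thus ?thesis using sub[OF M, of c] sub[of "M + c \<cdot>\<^sub>m 1\<^sub>m n" "- c"] M by auto
qed

text \<open>Edges join distinct vertices, so a minimal matrix must be moved off \<open>X\<close> and
  \<open>Y\<close>. A scalar shift keeps the centralizer, and the entry at (0, 0) rules out at most
  two values of \<open>c\<close>.\<close>

lemma exists_minimal_shift:
  fixes M X Y :: "'a::alg_closed_field mat"
  assumes min: "minimal_mat n M" and n: "n > 0"
  obtains c where "minimal_mat n (M + c \<cdot>\<^sub>m 1\<^sub>m n)" "M + c \<cdot>\<^sub>m 1\<^sub>m n \<noteq> X" "M + c \<cdot>\<^sub>m 1\<^sub>m n \<noteq> Y"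
proof -
  have M: "M \<in> carrier_mat n n" using min by (simp add: minimal_mat_def)
  obtain c where c: "c \<notin> {X $$ (0, 0) - M $$ (0, 0), Y $$ (0, 0) - M $$ (0, 0)}"
    using ex_new_if_finite[OF infinite_UNIV_alg_closed] by (metis finite.emptyI finite_insert)
  have "(M + c \<cdot>\<^sub>m 1\<^sub>m n) $$ (0, 0) = M $$ (0, 0) + c" using M n by simp
  hence "M + c \<cdot>\<^sub>m 1\<^sub>m n \<noteq> X" "M + c \<cdot>\<^sub>m 1\<^sub>m n \<noteq> Y" using c by auto
  moreover have "minimal_mat n (M + c \<cdot>\<^sub>m 1\<^sub>m n)"
    using min M unfolding minimal_mat_def centralizer_mat_add_smult_one[OF M] by simp
  ultimately show ?thesis using that by blast
qed

section \<open>Matrix units in centralizers of Jordan matrices\<close>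

lemma separated_links_False_inj:
  assumes "separated_links n e (\<lambda>_. False)" "i < n" "j < n" "i \<noteq> j"
  shows "e i \<noteq> e j"
  using assms unfolding separated_links_def by (metis linorder_neqE_nat order_refl)

text \<open>For \<open>f\<close> and \<open>l\<close> the first and last row of a block with
  eigenvalue \<open>d a\<close>, column \<open>f\<close> and row \<open>l\<close> of the Jordan
  matrix have \<open>d a\<close> as their only possible nonzero entry; both products with E_fl
  therefore equal d a times E_fl.\<close>

lemma separated_links_elementary:
  fixes d :: "nat \<Rightarrow> 'a::field"
  assumes sep: "separated_links n d s" and a: "s a"
  obtains f l where "f < n" "l < n" "f \<noteq> l" "elementary_mat n f l \<in> centralizer_mat n (linked_mat n d s)"
proof -
  have c: "compatible_links n d s" using sep by (simp add: separated_links_def)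
  \<comment> \<open>As blocks have different eigenvalues, this is the index set of the block of
    \<open>a\<close>; the link at \<open>a\<close> gives it at least two elements.\<close>
  define B where "B = {i. i < n \<and> d i = d a}"
  define f where "f = Min B"
  define l where "l = Max B"
  have B: "finite B" "a \<in> B" "Suc a \<in> B" using c a by (auto simp: B_def compatible_links_def intro: Suc_lessD)
  have "f \<in> B" "l \<in> B" unfolding f_def l_def using Min_in Max_in B by auto
  hence fl: "f < n" "l < n" "d f = d a" "d l = d a" by (auto simp: B_def)
  have "f \<le> a" "Suc a \<le> l" unfolding f_def l_def using B by auto
  hence neq: "f \<noteq> l" by simp
  have first: "\<not> (s i \<and> Suc i = f)" for i
  proof
    assume i: "s i \<and> Suc i = f"
    hence "i \<in> B" using c fl by (auto simp: B_def compatible_links_def)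
    hence "f \<le> i" unfolding f_def using B by simp
    thus False using i by simp
  qed
  have last: "\<not> s l"
  proof
    assume "s l"
    hence "Suc l \<in> B" using c fl by (auto simp: B_def compatible_links_def)
    hence "Suc l \<le> l" unfolding l_def using B by simp
    thus False by simp
  qed
  have "linked_mat n d s * elementary_mat n f l = elementary_mat n f l * linked_mat n d s"
  proof (rule eq_matI)
    fix i j assume "i < dim_row (elementary_mat n f l * linked_mat n d s)"
      "j < dim_col (elementary_mat n f l * linked_mat n d s)"
    hence ij: "i < n" "j < n" by (simp_all add: elementary_mat_def)
    have "(linked_mat n d s * elementary_mat n f l) $$ (i, j) = linked_mat n d s $$ (i, f) * (if j = l then 1 else 0)"
      by (subst elementary_mat_mult_right[OF linked_mat_carrier ij fl(1)]) simp
    also have "\<dots> = (if i = f \<and> j = l then d a else 0)"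
      using first[of i] ij fl by (auto simp: linked_mat_def)
    also have "\<dots> = (if i = f then linked_mat n d s $$ (l, j) else 0)"
      using last ij fl by (auto simp: linked_mat_def)
    also have "\<dots> = (elementary_mat n f l * linked_mat n d s) $$ (i, j)"
      by (rule elementary_mat_mult_left[OF linked_mat_carrier ij fl(2), symmetric])
    finally show "(linked_mat n d s * elementary_mat n f l) $$ (i, j) = (elementary_mat n f l * linked_mat n d s) $$ (i, j)" .
  qed (simp_all add: elementary_mat_def)
  hence "elementary_mat n f l \<in> centralizer_mat n (linked_mat n d s)" by (simp add: centralizer_mat_def)
  thus ?thesis using that fl neq by blast
qed

text \<open>Both products vanish, because \<open>l\<close> and \<open>m\<close> differ from
  \<open>f\<close>.\<close>

lemma elementary_mat_commute:
  assumes "f < n" "l < n" "m < n" "l \<noteq> f" "m \<noteq> f"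
  shows "elementary_mat n f l * elementary_mat n f m = (elementary_mat n f m * elementary_mat n f l :: 'a::field mat)"
proof (rule eq_matI)
  fix i j assume "i < dim_row (elementary_mat n f m * elementary_mat n f l :: 'a mat)"
    "j < dim_col (elementary_mat n f m * elementary_mat n f l :: 'a mat)"
  hence ij: "i < n" "j < n" by (simp_all add: elementary_mat_def)
  show "(elementary_mat n f l * elementary_mat n f m) $$ (i, j) = (elementary_mat n f m * elementary_mat n f l :: 'a mat) $$ (i, j)"
    unfolding elementary_mat_mult_left[OF elementary_mat_carrier ij assms(2)]
      elementary_mat_mult_left[OF elementary_mat_carrier ij assms(3)]
    using ij assms by (simp add: elementary_mat_def)
qed (simp_all add: elementary_mat_def)

lemma elementary_mat_not_scalar:
  assumes "f < n" "l < n" "f \<noteq> l"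
  shows "(elementary_mat n f l :: 'a::field mat) \<notin> scalar_matrices n"
proof
  assume "(elementary_mat n f l :: 'a mat) \<in> scalar_matrices n"
  then obtain c :: 'a where "elementary_mat n f l = c \<cdot>\<^sub>m 1\<^sub>m n" by (auto simp: scalar_matrices_def)
  hence "(elementary_mat n f l :: 'a mat) $$ (f, l) = (c \<cdot>\<^sub>m 1\<^sub>m n) $$ (f, l)" by simp
  thus False using assms by (simp add: elementary_mat_def)
qed

lemma commuting_graph_arc_iff:
  "(X, Y) \<in> parcs (commuting_graph n) \<longleftrightarrow>
     X \<in> carrier_mat n n \<and> X \<notin> scalar_matrices n \<and> Y \<in> carrier_mat n n \<and> Y \<notin> scalar_matrices n \<and>
     X \<noteq> Y \<and> X * Y = Y * X"
  by (auto simp: commuting_graph_def)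

theorem theorem2p14:
  fixes A :: "'a::alg_closed_field mat" and n :: nat
  assumes "n \<ge> 3"
    and "A \<in> carrier_mat n n"
    and "A \<notin> scalar_matrices n"
  shows "diagonalizable_mat A \<longleftrightarrow>
    (\<exists>B. minimal_mat n B \<and> B \<in> centralizer_mat n A \<and>
      (\<forall>X Y. vwalk [Y, X, B] (with_proj (commuting_graph n)) \<longrightarrow>
        (\<exists>M. minimal_mat n M \<and> vwalk [Y, M, X] (with_proj (commuting_graph n)))))"
proof
  assume "diagonalizable_mat A"
  then obtain D where diag: "diagonal_mat D" and sim: "similar_mat A D" by (auto simp: diagonalizable_mat_def)
  obtain P Q where inv: "inverse_mats n P Q" and D: "D \<in> carrier_mat n n"
    and AD: "A = inverse_mats.conj_mat P Q D"
    using similar_mat_inverse_mats[OF sim assms(2)] by blast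
  interpret inverse_mats n P Q by (rule inv)
  have no_links: "compatible_links n d (\<lambda>_. False)" for d :: "nat \<Rightarrow> 'a" by (simp add: compatible_links_def)
  obtain e :: "nat \<Rightarrow> 'a" where e: "separated_links n e (\<lambda>_. False)"
    using exists_separated_links[OF no_links] by blast
  let ?J = "linked_mat n e (\<lambda>_. False)"
  have cyc: "cyclic_mat n ?J" by (rule separated_linked_mat_cyclic[OF e])
  have DJ: "D * ?J = ?J * D"
  proof -
    have "D = linked_mat n (\<lambda>i. D $$ (i, i)) (\<lambda>_. False)"
      by (rule eq_matI) (use D diag in \<open>auto simp: linked_mat_def diagonal_mat_def\<close>)
    thus ?thesis using linked_mat_commute[OF no_links no_links] by metis
  qed
  show "\<exists>B. minimal_mat n B \<and> B \<in> centralizer_mat n A \<and>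
      (\<forall>X Y. vwalk [Y, X, B] (with_proj (commuting_graph n)) \<longrightarrow>
        (\<exists>M. minimal_mat n M \<and> vwalk [Y, M, X] (with_proj (commuting_graph n))))"
  proof (rule exI[of _ "conj_mat ?J"], intro conjI allI impI)
    show "minimal_mat n (conj_mat ?J)" by (rule cyclic_mat_minimal[OF cyclic_conj_mat[OF cyc]])
    show "conj_mat ?J \<in> centralizer_mat n A"
      unfolding AD centralizer_conj_mat[OF D] using DJ by (intro imageI) (simp add: centralizer_mat_def)
    fix X Y assume "vwalk [Y, X, conj_mat ?J] (with_proj (commuting_graph n))"
    hence YX: "(Y, X) \<in> parcs (commuting_graph n)" and XB: "(X, conj_mat ?J) \<in> parcs (commuting_graph n)"
      by (simp_all add: vwalk_commuting_graph_iff)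
    obtain U where U: "U \<in> carrier_mat n n" and XU: "X = conj_mat U"
      using conj_mat_cases YX unfolding commuting_graph_arc_iff by blast
    obtain V where V: "V \<in> carrier_mat n n" and YV: "Y = conj_mat V"
      using conj_mat_cases YX unfolding commuting_graph_arc_iff by blast
    have UV: "U * V = V * U"
      using YX conj_mat_commute_iff[OF V U] unfolding commuting_graph_arc_iff XU YV by simp
    have "U * ?J = ?J * U"
      using XB conj_mat_commute_iff[OF U linked_mat_carrier] unfolding commuting_graph_arc_iff XU by simp
    hence "U \<in> centralizer_mat n ?J" using U by (simp add: centralizer_mat_def)
    \<comment> \<open>\<open>U\<close> commutes with a diagonal matrix whose entries are pairwise
      distinct.\<close>
    hence "diagonal_mat U"
      using separated_linked_mat_centralizer[OF e] separated_links_False_inj[OF e] U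
      unfolding diagonal_mat_def by auto
    then obtain T where T: "T \<in> carrier_mat n n"
      "centralizer_mat n T \<subseteq> centralizer_mat n U \<inter> centralizer_mat n V"
      using exists_generic_combination[OF U V _ UV] by blast
    obtain N where N: "cyclic_mat n N" "N \<in> centralizer_mat n T" using exists_commuting_cyclic[OF T(1)] by blast
    have Nc: "N \<in> carrier_mat n n" using N(2) by (rule centralizer_matD)
    have min: "minimal_mat n (conj_mat N)" by (rule cyclic_mat_minimal[OF cyclic_conj_mat[OF N(1)]])
    \<comment> \<open>\<open>conj_mat N\<close> might equal \<open>X\<close> or \<open>Y\<close>,
      which an edge does not allow; the shift separates it from both.\<close>
    obtain c where c: "minimal_mat n (conj_mat N + c \<cdot>\<^sub>m 1\<^sub>m n)"
      "conj_mat N + c \<cdot>\<^sub>m 1\<^sub>m n \<noteq> X" "conj_mat N + c \<cdot>\<^sub>m 1\<^sub>m n \<noteq> Y"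
      using exists_minimal_shift[OF min, of X Y] assms(1) by auto
    let ?M = "conj_mat N + c \<cdot>\<^sub>m 1\<^sub>m n"
    have M: "?M \<in> carrier_mat n n" using c(1) by (simp add: minimal_mat_def)
    have comm: "?M * conj_mat W = conj_mat W * ?M" if W: "W \<in> carrier_mat n n" "N \<in> centralizer_mat n W" for W
    proof -
      have "W \<in> centralizer_mat n N" by (rule centralizer_mat_symI[OF W])
      hence "conj_mat W \<in> centralizer_mat n ?M"
        unfolding centralizer_mat_add_smult_one[OF conj_mat_carrier[OF Nc]] centralizer_conj_mat[OF Nc]
        by (rule imageI)
      thus ?thesis by (rule centralizer_matD)
    qed
    have "?M \<notin> scalar_matrices n" by (rule minimal_mat_not_scalar[OF c(1)]) (use assms(1) in simp)
    moreover have "?M * X = X * ?M" "?M * Y = Y * ?M"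
      unfolding XU YV using comm[OF U] comm[OF V] T(2) N(2) by blast+
    ultimately have "(Y, ?M) \<in> parcs (commuting_graph n)" "(?M, X) \<in> parcs (commuting_graph n)"
      using YX M c(2,3) unfolding commuting_graph_arc_iff by simp_all
    thus "\<exists>M. minimal_mat n M \<and> vwalk [Y, M, X] (with_proj (commuting_graph n))"
      using c(1) unfolding vwalk_commuting_graph_iff by blast
  qed
next
  assume "\<exists>B. minimal_mat n B \<and> B \<in> centralizer_mat n A \<and>
      (\<forall>X Y. vwalk [Y, X, B] (with_proj (commuting_graph n)) \<longrightarrow>
        (\<exists>M. minimal_mat n M \<and> vwalk [Y, M, X] (with_proj (commuting_graph n))))"
  then obtain B where min: "minimal_mat n B" and BA: "B \<in> centralizer_mat n A"
    and path: "\<And>X Y. (Y, X) \<in> parcs (commuting_graph n) \<Longrightarrow> (X, B) \<in> parcs (commuting_graph n) \<Longrightarrow>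
        \<exists>M. minimal_mat n M \<and> (Y, M) \<in> parcs (commuting_graph n) \<and> (M, X) \<in> parcs (commuting_graph n)"
    unfolding vwalk_commuting_graph_iff by blast
  have B: "B \<in> carrier_mat n n" using min by (simp add: minimal_mat_def)
  \<comment> \<open>Only the centralizer of \<open>B\<close> is put into Jordan shape here; it
    decides both which vertices are adjacent to \<open>B\<close> and where \<open>A\<close>
    lies.\<close>
  obtain P Q d s where inv: "inverse_mats n P Q" and sep: "separated_links n d s"
    and CB: "centralizer_mat n B = centralizer_mat n (inverse_mats.conj_mat P Q (linked_mat n d s))"
    using minimal_mat_separated[OF min] by blast
  interpret inverse_mats n P Q by (rule inv)
  note CB = CB[unfolded centralizer_conj_mat[OF linked_mat_carrier]]
  have no_links: "\<not> s a" for a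
  proof
    assume "s a"
    then obtain f l where fl: "f < n" "l < n" "f \<noteq> l"
      and E: "elementary_mat n f l \<in> centralizer_mat n (linked_mat n d s)"
      using separated_links_elementary[OF sep] by blast
    \<comment> \<open>Here \<open>n \<ge> 3\<close> enters: it leaves room for a third index
      \<open>m\<close>.\<close>
    have "card {f, l} < card {..<n}" using assms(1) fl by simp
    hence "\<not> {..<n} \<subseteq> {f, l}" using card_mono[of "{f, l}" "{..<n}"] by auto
    then obtain m where m: "m < n" "m \<noteq> f" "m \<noteq> l" by auto
    let ?X = "conj_mat (elementary_mat n f l)" and ?Y = "conj_mat (elementary_mat n f m)"
    have not_min: False if "minimal_mat n M" "?X \<in> centralizer_mat n M" "?Y \<in> centralizer_mat n M" for M
      using conj_elementary_not_minimal[OF inv that(1) fl(1,2) m(1) _ that(2,3)] m(3) by blast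
    have "(elementary_mat n f m :: 'a mat) $$ (f, m) \<noteq> (elementary_mat n f l :: 'a mat) $$ (f, m)"
      using fl m by (simp add: elementary_mat_def)
    hence neq: "?Y \<noteq> ?X" using conj_mat_eq_iff[OF elementary_mat_carrier elementary_mat_carrier] by metis
    have YX: "?Y * ?X = ?X * ?Y"
      unfolding conj_mat_commute_iff[OF elementary_mat_carrier elementary_mat_carrier]
      by (rule elementary_mat_commute) (use fl m in auto)
    have ns: "?X \<notin> scalar_matrices n" "?Y \<notin> scalar_matrices n" "B \<notin> scalar_matrices n"
      using fl m minimal_mat_not_scalar[OF min] assms(1)
      by (auto simp: scalar_conj_mat_iff elementary_mat_not_scalar)
    have XB: "?X \<in> centralizer_mat n B" unfolding CB using E by (rule imageI)
    \<comment> \<open>The edge from \<open>?X\<close> to \<open>B\<close> needs distinct ends. If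
      they coincided, \<open>?Y\<close> would commute with \<open>B\<close> as well, contradicting
      the minimality of \<open>B\<close>.\<close>
    have "?X \<noteq> B"
    proof
      assume "?X = B"
      moreover have "?Y \<in> centralizer_mat n ?X" using YX by (simp add: centralizer_mat_def)
      ultimately show False using not_min[OF min XB] by simp
    qed
    hence "(?Y, ?X) \<in> parcs (commuting_graph n)" "(?X, B) \<in> parcs (commuting_graph n)"
      using ns neq YX B centralizer_matD(2)[OF XB] unfolding commuting_graph_arc_iff by simp_all
    from path[OF this] obtain M where "minimal_mat n M" "(?Y, M) \<in> parcs (commuting_graph n)"
      "(M, ?X) \<in> parcs (commuting_graph n)" by blast
    thus False using not_min[of M] unfolding commuting_graph_arc_iff centralizer_mat_def by simp
  qed
  have "A \<in> centralizer_mat n B" by (rule centralizer_mat_symI[OF assms(2) BA])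
  then obtain D where D: "D \<in> centralizer_mat n (linked_mat n d s)" and AD: "A = conj_mat D"
    unfolding CB by blast
  \<comment> \<open>Without links the Jordan matrix is diagonal with distinct entries, so its
    centralizer, which contains \<open>D\<close>, consists of diagonal matrices.\<close>
  have sF: "s = (\<lambda>_. False)" using no_links by auto
  have Dc: "D \<in> carrier_mat n n" using D by (rule centralizer_matD)
  have "diagonal_mat D"
    using separated_linked_mat_centralizer[OF sep D] separated_links_False_inj[OF sep[unfolded sF]] Dc
    unfolding diagonal_mat_def by auto
  moreover have "similar_mat A D"
    by (rule similar_matI[of _ _ P Q]) (use assms(2) Dc P Q PQ QP AD conj_mat_def in auto)
  ultimately show "diagonalizable_mat A" unfolding diagonalizable_mat_def by blast
qed

end
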